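(* Let $\mathbb{K}$ be a field and $\mathcal{S}$ a linear subspace of $\mathrm{M}_{n,p}(\mathbb{K})$ with $\operatorname{codim}\mathcal{S}\leq 2n-3$, such that every $M\in\mathcal{S}$ has the form $M=\begin{bmatrix}m_{1,1}&L(M)\\ 0_{(n-1)\times 1}&K(M)\end{bmatrix}$ (with $L(M)\in\mathrm{M}_{1,p-1}(\mathbb{K})$, $K(M)\in\mathrm{M}_{n-1,p-1}(\mathbb{K})$) and some $M\in\mathcal{S}$ has a nonzero first column. Let $q\geq 1$. Then the range-preserving group homomorphisms $F:\mathcal{S}\to\mathrm{M}_{n,q}(\mathbb{K})$ are exactly the maps $$M\longmapsto\begin{bmatrix}R(m_{1,1}) & L(M)+R'(m_{1,1})\\ 0_{(n-1)\times(q-p+1)} & K(M)\end{bmatrix}Q,$$ where $Q\in\mathrm{GL}_q(\mathbb{K})$ and $R:\mathbb{K}\to\mathrm{M}_{1,q-p+1}(\mathbb{K})$, $R':\mathbb{K}\to\mathrm{M}_{1,p-1}(\mathbb{K})$ are group homomorphisms with $R$ injective. Such homomorphisms exist if and only if $q\geq p$.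
   Context: A map $F:\mathcal{S}\to\mathrm{M}_{n,q}(\mathbb{K})$ is range-preserving when the column space of $F(M)$ equals that of $M$ for all $M\in\mathcal{S}$. *)

theory Defs
  imports "Jordan_Normal_Form.Matrix"
begin

definition subspace_mat :: "nat \<Rightarrow> nat \<Rightarrow> 'a::field mat set \<Rightarrow> bool" where
  "subspace_mat n p S \<longleftrightarrow> S \<subseteq> carrier_mat n p \<and> 0\<^sub>m n p \<in> S \<and>
     (\<forall>A\<in>S. \<forall>B\<in>S. A + B \<in> S) \<and> (\<forall>c. \<forall>A\<in>S. c \<cdot>\<^sub>m A \<in> S)"

definition lincomb_mat :: "nat \<Rightarrow> nat \<Rightarrow> 'a::field list \<Rightarrow> 'a mat list \<Rightarrow> 'a mat" where
  "lincomb_mat n p cs Ms = foldr (\<lambda>(c, M) acc. c \<cdot>\<^sub>m M + acc) (zip cs Ms) (0\<^sub>m n p)"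

definition lin_indep_mat :: "nat \<Rightarrow> nat \<Rightarrow> 'a::field mat list \<Rightarrow> bool" where
  "lin_indep_mat n p Ms \<longleftrightarrow> set Ms \<subseteq> carrier_mat n p \<and>
     (\<forall>cs. length cs = length Ms \<and> lincomb_mat n p cs Ms = 0\<^sub>m n p \<longrightarrow> (\<forall>c\<in>set cs. c = 0))"

definition dim_mat_space :: "nat \<Rightarrow> nat \<Rightarrow> 'a::field mat set \<Rightarrow> nat" where
  "dim_mat_space n p S = Max {length Ms | Ms. set Ms \<subseteq> S \<and> lin_indep_mat n p Ms}"

definition codim_mat_space :: "nat \<Rightarrow> nat \<Rightarrow> 'a::field mat set \<Rightarrow> nat" where
  "codim_mat_space n p S = n * p - dim_mat_space n p S"

definition col_space :: "'a::field mat \<Rightarrow> 'a vec set" where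
  "col_space M = {M *\<^sub>v v | v. v \<in> carrier_vec (dim_col M)}"

definition additive_on_mat :: "'a::field mat set \<Rightarrow> nat \<Rightarrow> nat \<Rightarrow> ('a mat \<Rightarrow> 'a mat) \<Rightarrow> bool" where
  "additive_on_mat S n q F \<longleftrightarrow> (\<forall>M\<in>S. F M \<in> carrier_mat n q) \<and>
     (\<forall>A\<in>S. \<forall>B\<in>S. F (A + B) = F A + F B)"

definition range_preserving :: "'a::field mat set \<Rightarrow> ('a mat \<Rightarrow> 'a mat) \<Rightarrow> bool" where
  "range_preserving S F \<longleftrightarrow> (\<forall>M\<in>S. col_space (F M) = col_space M)"

definition additive_row :: "nat \<Rightarrow> ('a::field \<Rightarrow> 'a mat) \<Rightarrow> bool" where
  "additive_row r R \<longleftrightarrow> (\<forall>a. R a \<in> carrier_mat 1 r) \<and> (\<forall>a b. R (a + b) = R a + R b)"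

(* blocks of M = [m11 L(M); 0 K(M)] *)
definition L_blk :: "nat \<Rightarrow> 'a mat \<Rightarrow> 'a mat" where
  "L_blk p M = mat 1 (p - 1) (\<lambda>(i, j). M $$ (0, j + 1))"

definition K_blk :: "nat \<Rightarrow> nat \<Rightarrow> 'a mat \<Rightarrow> 'a mat" where
  "K_blk n p M = mat (n - 1) (p - 1) (\<lambda>(i, j). M $$ (i + 1, j + 1))"

end

theory Submission
  imports Defs "HOL-Library.Function_Algebras" "Jordan_Normal_Form.Determinant"
begin

text \<open>
  Two column spaces agree iff the matrices have the same left kernel, so every column \<open>f\<close> of a
  range-preserving \<open>F\<close> satisfies: \<open>y M = 0\<close> implies \<open>y f(M) = 0\<close>. Let \<open>S\<^sub>0\<close> be the matrices of \<open>S\<close>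
  with zero first column; it has codimension at most \<open>n - 2\<close> among the \<open>n\<close> by \<open>p - 1\<close> matrices. On
  such a space \<open>f\<close> is of the form \<open>M \<mapsto> M x\<close>: delete a row met by some linear form that vanishes on
  the space (this lowers the codimension), use induction, and recover the deleted row from a
  matrix in which another row is opposite to it; there is such a matrix, since otherwise \<open>n - 1\<close>
  independent forms would vanish. The same count of forms, for suitable vectors \<open>y\<close>, shows
  that the remaining part of \<open>F\<close> (an additive function of \<open>m\<^sub>1\<^sub>1\<close>) only affects the first row, that
  the matrix of all the \<open>x\<close> has independent rows and so extends to \<open>Q\<close>, and that \<open>R\<close> is injective.
\<close>

subsection \<open>Independent families of functions\<close>

text \<open>The map \<open>F\<close> is only additive, so linearity over the field has to be
  extracted from left kernels, and this takes two rows at once: on a space of matrices with a single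
  row, every injective additive map has the right left kernels. The first column of \<open>S\<close>
  is such a one-row situation, which is where the arbitrary injective homomorphism \<open>R\<close>
  comes from.

  The constant splits as 2n - 3 = (n - 1) + (n - 2). The n - 1 zero entries of the first column are
  forms that vanish on \<open>S\<close>, so n - 2 forms are left for the matrices with zero first
  column. This is one less than the number of rows other than a given one, and every row in which a
  prescription fails costs one independent form. Hence some row can be prescribed, but which one is
  not under control: each construction has to work for whatever row is delivered.\<close>

interpretation fun_vs: Vector_Spaces.vector_space "\<lambda>(c::'a::field) (f::'i \<Rightarrow> 'a) i. c * f i"
  by unfold_locales (auto simp: fun_eq_iff algebra_simps)

interpretation field_vs: Vector_Spaces.vector_space "(*) :: 'a::field \<Rightarrow> 'a \<Rightarrow> 'a"
  by unfold_locales (auto simp: algebra_simps)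

interpretation fun_field_vs: Vector_Spaces.vector_space_pair
  "\<lambda>(c::'a::field) (f::'i \<Rightarrow> 'a) i. c * f i" "(*) :: 'a::field \<Rightarrow> 'a \<Rightarrow> 'a"
  by unfold_locales

text \<open>The interpretation for the field itself would rewrite \<open>a * (b * c)\<close> to \<open>a * b * c\<close>,
  which loops with \<open>ac_simps\<close>.\<close>
declare field_vs.scale_scale [simp del]

definition unit_fun :: "'i \<Rightarrow> 'i \<Rightarrow> 'a::field" where
  "unit_fun z = (\<lambda>w. if w = z then 1 else 0)"

lemma sum_fun_apply: "(\<Sum>j\<in>J. f j) z = (\<Sum>j\<in>J. (f j z :: 'a::field))"
  by (induction J rule: infinite_finite_induct) (auto simp: plus_fun_def zero_fun_def)

lemma supported_eq_sum_unit_fun: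
  assumes "finite Z" "\<And>z. z \<notin> Z \<Longrightarrow> u z = (0::'a::field)"
  shows "u = (\<Sum>z\<in>Z. (\<lambda>i. u z * unit_fun z i))"
proof
  fix i
  have "(\<Sum>z\<in>Z. u z * unit_fun z i) = (\<Sum>z\<in>Z. if z = i then u z else 0)"
    by (rule sum.cong) (auto simp: unit_fun_def)
  also have "\<dots> = u i" using assms by (simp add: sum.delta)
  finally show "u i = (\<Sum>z\<in>Z. (\<lambda>i. u z * unit_fun z i)) i"
    by (simp add: sum_fun_apply)
qed

lemma supported_in_span:
  assumes "finite Z" "\<And>z. z \<notin> Z \<Longrightarrow> u z = (0::'a::field)"
  shows "u \<in> fun_vs.span (unit_fun ` Z)"
proof -
  have "(\<Sum>z\<in>Z. (\<lambda>i. u z * unit_fun z i)) \<in> fun_vs.span (unit_fun ` Z)"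
    by (intro fun_vs.span_sum fun_vs.span_scale fun_vs.span_base) auto
  then show ?thesis using supported_eq_sum_unit_fun[OF assms] by simp
qed

text \<open>Restricted to \<open>Z\<close>, the set \<open>W\<close> becomes a subspace that misses
  the restriction of \<open>u\<close>. A basis of it stays independent when that restriction is
  added, so some linear functional is 0 on the basis and 1 at the added vector; its values at the
  unit functions are the coefficients \<open>x\<close>. Existence proofs below use this as an
  alternative: a prescribed vector is attained, or a form rejects it.\<close>

lemma separating_functional:
  fixes W :: "('i \<Rightarrow> 'a::field) set"
  assumes Z: "finite Z" and W: "W \<noteq> {}"
    and add: "\<And>v w. v \<in> W \<Longrightarrow> w \<in> W \<Longrightarrow> (\<lambda>z. v z + w z) \<in> W"
    and scale: "\<And>c w. w \<in> W \<Longrightarrow> (\<lambda>z. c * w z) \<in> W"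
    and u: "\<And>w. w \<in> W \<Longrightarrow> \<exists>z\<in>Z. w z \<noteq> u z"
  shows "\<exists>x. (\<forall>w\<in>W. (\<Sum>z\<in>Z. x z * w z) = 0) \<and> (\<Sum>z\<in>Z. x z * u z) \<noteq> 0"
proof -
  define r where "r = (\<lambda>(w::'i \<Rightarrow> 'a) z. if z \<in> Z then w z else 0)"
  have sub: "fun_vs.subspace (r ` W)"
  proof (rule fun_vs.subspaceI)
    obtain w where "w \<in> W" using W by auto
    then have "(\<lambda>z. 0 * w z) \<in> W" by (rule scale)
    then have "r (\<lambda>z. 0 * w z) \<in> r ` W" by blast
    moreover have "r (\<lambda>z. 0 * w z) = 0" by (auto simp: r_def fun_eq_iff)
    ultimately show "0 \<in> r ` W" by simp
  next
    fix v w assume "v \<in> r ` W" "w \<in> r ` W"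
    then obtain v' w' where *: "v' \<in> W" "w' \<in> W" "v = r v'" "w = r w'" by auto
    have "v + w = r (\<lambda>z. v' z + w' z)" by (auto simp: * r_def fun_eq_iff)
    with add[OF *(1,2)] show "v + w \<in> r ` W" by blast
  next
    fix c w assume "w \<in> r ` W"
    then obtain w' where *: "w' \<in> W" "w = r w'" by auto
    have "(\<lambda>i. c * w i) = r (\<lambda>z. c * w' z)" by (auto simp: * r_def fun_eq_iff)
    with scale[OF *(1)] show "(\<lambda>i. c * w i) \<in> r ` W" by blast
  qed
  obtain B where B: "B \<subseteq> r ` W" "fun_vs.independent B" "r ` W \<subseteq> fun_vs.span B"
    using fun_vs.maximal_independent_subset by blast
  have spanB: "fun_vs.span B = r ` W"
    using B sub fun_vs.span_minimal by blast
  have "r u \<notin> r ` W"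
  proof
    assume "r u \<in> r ` W"
    then obtain w where w: "w \<in> W" "r u = r w" by auto
    then have "\<forall>z\<in>Z. w z = u z" unfolding r_def fun_eq_iff by metis
    with u[OF w(1)] show False by auto
  qed
  then have ru: "r u \<notin> fun_vs.span B" using spanB by simp
  have ind: "fun_vs.independent (insert (r u) B)"
    by (rule fun_vs.independent_insertI[OF ru B(2)])
  have nB: "r u \<notin> B" using ru fun_vs.span_base by blast
  obtain g where g: "Vector_Spaces.linear (\<lambda>(c::'a) (f::'i \<Rightarrow> 'a) i. c * f i) (*) g"
    and gB: "\<forall>b\<in>insert (r u) B. g b = (if b = r u then 1 else 0)"
    using fun_field_vs.linear_independent_extend[OF ind, of "\<lambda>b. if b = r u then 1 else 0"] by blast
  interpret g: Vector_Spaces.linear "\<lambda>(c::'a) (f::'i \<Rightarrow> 'a) i. c * f i" "(*)" g by (rule g)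
  have g0: "g w = 0" if "w \<in> r ` W" for w
  proof -
    have "w \<in> fun_vs.span B" using that spanB by simp
    then show ?thesis
    proof (rule fun_vs.span_induct_alt)
      show "g 0 = 0" by (rule g.zero)
      show "g ((\<lambda>i. c * x i) + y) = 0" if "x \<in> B" "g y = 0" for c x y
        using that gB nB by (auto simp: g.add g.scale)
    qed
  qed
  define x where "x = (\<lambda>z. g (unit_fun z))"
  have gx: "g (r w) = (\<Sum>z\<in>Z. x z * w z)" for w
  proof -
    have "r w = (\<Sum>z\<in>Z. (\<lambda>i. r w z * unit_fun z i))"
      by (rule supported_eq_sum_unit_fun[OF Z]) (simp add: r_def)
    then have "g (r w) = (\<Sum>z\<in>Z. g (\<lambda>i. r w z * unit_fun z i))"
      using g.sum by metis
    also have "\<dots> = (\<Sum>z\<in>Z. x z * w z)"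
      by (rule sum.cong) (auto simp: g.scale x_def r_def)
    finally show ?thesis .
  qed
  show ?thesis
  proof (intro exI[of _ x] conjI ballI)
    show "(\<Sum>z\<in>Z. x z * w z) = 0" if "w \<in> W" for w
      using g0[of "r w"] gx that by auto
    show "(\<Sum>z\<in>Z. x z * u z) \<noteq> 0" using gB gx[of u] by auto
  qed
qed

text \<open>Families instead of sets: a repeated member counts as a dependence, so the number of
  indices is the number of forms, and forms produced one per row need no separate proof of
  distinctness.\<close>

definition indep_fam :: "'j set \<Rightarrow> ('j \<Rightarrow> 'i \<Rightarrow> 'a::field) \<Rightarrow> bool" where
  "indep_fam J v \<longleftrightarrow> (\<forall>a. (\<forall>z. (\<Sum>j\<in>J. a j * v j z) = 0) \<longrightarrow> (\<forall>j\<in>J. a j = 0))"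

lemma indep_famD:
  "indep_fam J v \<Longrightarrow> (\<And>z. (\<Sum>j\<in>J. a j * v j z) = 0) \<Longrightarrow> j \<in> J \<Longrightarrow> a j = 0"
  unfolding indep_fam_def by blast

lemma indep_fam_inj_on:
  assumes "finite J" "indep_fam J v"
  shows "inj_on v J"
proof (rule inj_onI, rule ccontr)
  fix j k assume jk: "j \<in> J" "k \<in> J" "v j = v k" "j \<noteq> k"
  define a :: "'a \<Rightarrow> 'c" where "a = (\<lambda>i. if i = j then 1 else if i = k then -1 else 0)"
  have "(\<Sum>i\<in>J. a i * v i z) = 0" for z
  proof -
    have "(\<Sum>i\<in>J. a i * v i z) = (\<Sum>i\<in>J. (if i = j then v j z else 0) + (if i = k then - v k z else 0))"
      by (rule sum.cong) (use jk in \<open>auto simp: a_def\<close>)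
    also have "\<dots> = 0" using jk assms(1) by (simp add: sum.distrib)
    finally show ?thesis .
  qed
  from indep_famD[OF assms(2) this jk(1)] show False by (simp add: a_def)
qed

lemma indep_fam_independent:
  assumes "finite J" "indep_fam J v"
  shows "fun_vs.independent (v ` J)"
proof (rule fun_vs.independent_if_scalars_zero)
  show "finite (v ` J)" using assms by simp
  fix f w assume s: "(\<Sum>w\<in>v ` J. (\<lambda>i. f w * w i)) = 0" and w: "w \<in> v ` J"
  have s': "(\<Sum>j\<in>J. (\<lambda>i. f (v j) * v j i)) = 0"
    using s indep_fam_inj_on[OF assms] by (simp add: sum.reindex)
  have "(\<Sum>j\<in>J. f (v j) * v j z) = 0" for z
    using fun_cong[OF s', of z] by (simp add: sum_fun_apply)
  from indep_famD[OF assms(2) this] w show "f w = 0" by auto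
qed

lemma indep_fam_card_le:
  assumes "finite J" "indep_fam J v" "finite Z" "\<And>j z. j \<in> J \<Longrightarrow> z \<notin> Z \<Longrightarrow> v j z = 0"
  shows "card J \<le> card Z"
proof -
  have "v ` J \<subseteq> fun_vs.span (unit_fun ` Z)"
    using assms by (auto intro!: supported_in_span)
  then have "card (v ` J) \<le> card (unit_fun ` Z :: ('b \<Rightarrow> 'c) set)"
    using fun_vs.independent_span_bound[OF _ indep_fam_independent[OF assms(1,2)]] assms(3) by blast
  also have "\<dots> \<le> card Z" by (rule card_image_le[OF assms(3)])
  finally show ?thesis using card_image[OF indep_fam_inj_on[OF assms(1,2)]] by simp
qed

text \<open>If no \<open>x\<close> were dual to \<open>v j\<close>, a form separating the tuples of
  pairings from the unit tuple at \<open>j\<close> would be a linear relation among the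
  \<open>v i\<close> with nonzero coefficient at \<open>j\<close>.\<close>

lemma indep_fam_dual:
  fixes v :: "'j \<Rightarrow> 'i \<Rightarrow> 'a::field"
  assumes J: "finite J" "indep_fam J v" and Z: "finite Z" and supp: "\<And>j z. j \<in> J \<Longrightarrow> z \<notin> Z \<Longrightarrow> v j z = 0"
    and j: "j \<in> J"
  obtains x where "\<And>z. z \<notin> Z \<Longrightarrow> x z = 0"
    "\<And>i. i \<in> J \<Longrightarrow> (\<Sum>z\<in>Z. v i z * x z) = (if i = j then 1 else 0)"
proof -
  define W where "W = range (\<lambda>x i. \<Sum>z\<in>Z. v i z * x z)"
  have "\<exists>w\<in>W. \<forall>i\<in>J. w i = unit_fun j i"
  proof (rule ccontr)
    assume "\<not> ?thesis"
    then have no: "\<And>w. w \<in> W \<Longrightarrow> \<exists>i\<in>J. w i \<noteq> unit_fun j i" by blast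
    have W1: "W \<noteq> {}" by (auto simp: W_def)
    have W2: "(\<lambda>i. a i + b i) \<in> W" if "a \<in> W" "b \<in> W" for a b
    proof -
      from that obtain x y where "a = (\<lambda>i. \<Sum>z\<in>Z. v i z * x z)" "b = (\<lambda>i. \<Sum>z\<in>Z. v i z * y z)"
        by (auto simp: W_def)
      then have "(\<lambda>i. a i + b i) = (\<lambda>i. \<Sum>z\<in>Z. v i z * (x z + y z))"
        by (simp add: sum.distrib algebra_simps)
      then show ?thesis unfolding W_def by (rule range_eqI[where x = "\<lambda>z. x z + y z"])
    qed
    have W3: "(\<lambda>i. c * a i) \<in> W" if "a \<in> W" for c a
    proof -
      from that obtain x where "a = (\<lambda>i. \<Sum>z\<in>Z. v i z * x z)"
        by (auto simp: W_def)
      then have "(\<lambda>i. c * a i) = (\<lambda>i. \<Sum>z\<in>Z. v i z * (c * x z))"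
        by (simp add: sum_distrib_left algebra_simps)
      then show ?thesis unfolding W_def by (rule range_eqI[where x = "\<lambda>z. c * x z"])
    qed
    obtain c where c: "\<And>w. w \<in> W \<Longrightarrow> (\<Sum>i\<in>J. c i * w i) = 0"
      and cj: "(\<Sum>i\<in>J. c i * unit_fun j i) \<noteq> 0"
      using separating_functional[OF J(1) W1 W2 W3 no] by blast
    \<comment> \<open>Evaluating \<open>c\<close> on the pairings with the unit function at
      \<open>z\<close> gives the relation at the position \<open>z\<close>.\<close>
    have "(\<Sum>i\<in>J. c i * v i z) = 0" for z
    proof (cases "z \<in> Z")
      case True
      have "(\<Sum>y\<in>Z. v i y * unit_fun z y) = v i z" for i
        using True Z by (simp add: unit_fun_def if_distrib cong: if_cong)
      moreover have "(\<lambda>i. \<Sum>y\<in>Z. v i y * unit_fun z y) \<in> W" unfolding W_def by blast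
      ultimately show ?thesis using c by fastforce
    next
      case False
      then show ?thesis using supp by (auto intro!: sum.neutral)
    qed
    then have "\<forall>i\<in>J. c i = 0" using indep_famD[OF J(2)] by blast
    with cj show False by simp
  qed
  then obtain x where x: "\<forall>i\<in>J. (\<Sum>z\<in>Z. v i z * x z) = unit_fun j i"
    unfolding W_def by blast
  show thesis
  proof (rule that)
    show "z \<notin> Z \<Longrightarrow> (if z \<in> Z then x z else 0) = 0" for z by simp
    show "(\<Sum>z\<in>Z. v i z * (if z \<in> Z then x z else 0)) = (if i = j then 1 else 0)" if "i \<in> J" for i
    proof -
      have "(\<Sum>z\<in>Z. v i z * (if z \<in> Z then x z else 0)) = (\<Sum>z\<in>Z. v i z * x z)"
        by (rule sum.cong) auto
      then show ?thesis using x that by (simp add: unit_fun_def)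
    qed
  qed
qed

text \<open>Over a general field the standard pairing has isotropic vectors, so \<open>v\<close> and
  \<open>w\<close> together may be dependent although they are orthogonal. The vectors
  \<open>X\<close> dual to \<open>v\<close> take its place: pairing a relation with
  \<open>v i\<close> removes every \<open>w k\<close> and isolates the coefficient of
  \<open>X i\<close>.\<close>

lemma card_orthogonal_indep_fams:
  fixes v :: "'j \<Rightarrow> 'i \<Rightarrow> 'a::field" and w :: "'k \<Rightarrow> 'i \<Rightarrow> 'a"
  assumes J: "finite J" "indep_fam J v" "\<And>j z. j \<in> J \<Longrightarrow> z \<notin> Z \<Longrightarrow> v j z = 0"
    and K: "finite K" "indep_fam K w" "\<And>k z. k \<in> K \<Longrightarrow> z \<notin> Z \<Longrightarrow> w k z = 0"
    and Z: "finite Z"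
    and orth: "\<And>j k. j \<in> J \<Longrightarrow> k \<in> K \<Longrightarrow> (\<Sum>z\<in>Z. v j z * w k z) = 0"
  shows "card J + card K \<le> card Z"
proof -
  have "\<forall>j\<in>J. \<exists>x. (\<forall>z. z \<notin> Z \<longrightarrow> x z = 0) \<and>
      (\<forall>i\<in>J. (\<Sum>z\<in>Z. v i z * x z) = (if i = j then 1 else 0))"
    using indep_fam_dual[OF J(1,2) Z J(3)] by metis
  then obtain X where X: "\<And>j z. j \<in> J \<Longrightarrow> z \<notin> Z \<Longrightarrow> X j z = 0"
      "\<And>i j. i \<in> J \<Longrightarrow> j \<in> J \<Longrightarrow> (\<Sum>z\<in>Z. v i z * X j z) = (if i = j then 1 else 0)"
    by metis
  define u where "u = case_sum X w"
  have "indep_fam (J <+> K) u"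
    unfolding indep_fam_def
  proof (intro allI impI)
    fix a assume "\<forall>z. (\<Sum>s\<in>J <+> K. a s * u s z) = 0"
    then have s: "(\<Sum>j\<in>J. a (Inl j) * X j z) + (\<Sum>k\<in>K. a (Inr k) * w k z) = 0" for z
      using J(1) K(1) by (simp add: sum.Plus u_def)
    have aJ: "a (Inl i) = 0" if i: "i \<in> J" for i
    proof -
      have "0 = (\<Sum>z\<in>Z. v i z * ((\<Sum>j\<in>J. a (Inl j) * X j z) + (\<Sum>k\<in>K. a (Inr k) * w k z)))"
        by (simp add: s)
      also have "\<dots> = (\<Sum>z\<in>Z. \<Sum>j\<in>J. a (Inl j) * (v i z * X j z))
          + (\<Sum>z\<in>Z. \<Sum>k\<in>K. a (Inr k) * (v i z * w k z))"
        by (simp add: distrib_left sum.distrib sum_distrib_left ac_simps)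
      also have "\<dots> = (\<Sum>j\<in>J. a (Inl j) * (\<Sum>z\<in>Z. v i z * X j z))
          + (\<Sum>k\<in>K. a (Inr k) * (\<Sum>z\<in>Z. v i z * w k z))"
        by (subst (1 2) sum.swap) (simp only: sum_distrib_left)
      also have "\<dots> = (\<Sum>j\<in>J. if j = i then a (Inl j) else 0) + 0"
        using X(2)[OF i] orth[OF i]
        by (intro arg_cong2[where f="(+)"] sum.cong sum.neutral) auto
      also have "\<dots> = a (Inl i)" using i J(1) by simp
      finally show ?thesis by simp
    qed
    have "(\<Sum>k\<in>K. a (Inr k) * w k z) = 0" for z using s[of z] aJ by simp
    then have "a (Inr k) = 0" if "k \<in> K" for k
      using indep_famD[OF K(2), of "\<lambda>k. a (Inr k)"] that by blast
    then show "\<forall>s\<in>J <+> K. a s = 0" using aJ by auto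
  qed
  then have "card (J <+> K) \<le> card Z"
    by (rule indep_fam_card_le[rotated]) (use J K Z X in \<open>auto simp: u_def\<close>)
  then show ?thesis using J(1) K(1) by (simp add: card_Plus)
qed

subsection \<open>Range-compatible additive maps on spaces of small codimension\<close>

definition annihilates :: "'a::field mat set \<Rightarrow> (nat \<times> nat) set \<Rightarrow> (nat \<times> nat \<Rightarrow> 'a) \<Rightarrow> bool" where
  "annihilates T Z B \<longleftrightarrow> (\<forall>z. z \<notin> Z \<longrightarrow> B z = 0) \<and> (\<forall>N\<in>T. (\<Sum>z\<in>Z. B z * N $$ z) = 0)"

text \<open>This bounds the codimension of the projection of \<open>T\<close> to the positions
  \<open>Z\<close>, counted through its annihilator. In this form \<open>T\<close> stays fixed while
  rows are deleted from \<open>Z\<close>, and a bound is contradicted by exhibiting forms. The index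
  type is fixed to \<open>nat\<close> since a definition cannot quantify over types.\<close>

definition codim_le :: "'a::field mat set \<Rightarrow> (nat \<times> nat) set \<Rightarrow> nat \<Rightarrow> bool" where
  "codim_le T Z m \<longleftrightarrow> (\<forall>(J :: nat set) B. finite J \<longrightarrow> indep_fam J B \<longrightarrow>
     (\<forall>j\<in>J. annihilates T Z (B j)) \<longrightarrow> card J \<le> m)"

lemma codim_leD:
  "codim_le T Z m \<Longrightarrow> finite J \<Longrightarrow> indep_fam J B \<Longrightarrow> (\<And>j. j \<in> J \<Longrightarrow> annihilates T Z (B j)) \<Longrightarrow>
    card (J :: nat set) \<le> m"
  unfolding codim_le_def by blast

lemma annihilates_mono:
  assumes "annihilates T Z B" "Z \<subseteq> Z'" "finite Z'"
  shows "annihilates T Z' B"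
proof -
  have "(\<Sum>z\<in>Z'. B z * N $$ z) = (\<Sum>z\<in>Z. B z * N $$ z)" for N
    using assms by (intro sum.mono_neutral_right) (auto simp: annihilates_def)
  then show ?thesis using assms unfolding annihilates_def by auto
qed

lemma annihilates_restrict:
  assumes "\<And>N. N \<in> T \<Longrightarrow> (\<Sum>z\<in>Z. x z * N $$ z) = 0"
  shows "annihilates T Z (\<lambda>z. if z \<in> Z then x z else 0)"
proof -
  have "(\<Sum>z\<in>Z. (if z \<in> Z then x z else 0) * N $$ z) = (\<Sum>z\<in>Z. x z * N $$ z)" for N
    by (rule sum.cong) auto
  then show ?thesis using assms by (auto simp: annihilates_def)
qed

lemma subspace_matD:
  assumes "subspace_mat n p T"
  shows "N \<in> T \<Longrightarrow> N \<in> carrier_mat n p" "0\<^sub>m n p \<in> T"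
    "A \<in> T \<Longrightarrow> B \<in> T \<Longrightarrow> A + B \<in> T" "A \<in> T \<Longrightarrow> c \<cdot>\<^sub>m A \<in> T"
  using assms unfolding subspace_mat_def by auto

lemma separating_entries:
  assumes T: "subspace_mat n p T" and Z: "Z \<subseteq> {..<n} \<times> {..<p}"
    and u: "\<And>N. N \<in> T \<Longrightarrow> \<exists>z\<in>Z. N $$ z \<noteq> u z"
  shows "\<exists>x. (\<forall>N\<in>T. (\<Sum>z\<in>Z. x z * N $$ z) = 0) \<and> (\<Sum>z\<in>Z. x z * u z) \<noteq> 0"
proof -
  note T = subspace_matD[OF T]
  define W where "W = (\<lambda>N z. if z \<in> Z then N $$ z else 0) ` T"
  have Zfin: "finite Z" using Z finite_subset by blast
  have W1: "W \<noteq> {}" using T(2) by (auto simp: W_def)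
  have W2: "(\<lambda>z. v z + w z) \<in> W" if "v \<in> W" "w \<in> W" for v w
  proof -
    from that obtain A B where *: "A \<in> T" "B \<in> T"
      "v = (\<lambda>z. if z \<in> Z then A $$ z else 0)" "w = (\<lambda>z. if z \<in> Z then B $$ z else 0)"
      by (auto simp: W_def)
    have "(\<lambda>z. v z + w z) = (\<lambda>z. if z \<in> Z then (A + B) $$ z else 0)"
      using Z T(1)[OF *(1)] T(1)[OF *(2)] by (auto simp: * fun_eq_iff)
    then show ?thesis unfolding W_def by (rule image_eqI) (rule T(3)[OF *(1,2)])
  qed
  have W3: "(\<lambda>z. c * w z) \<in> W" if "w \<in> W" for c w
  proof -
    from that obtain A where *: "A \<in> T" "w = (\<lambda>z. if z \<in> Z then A $$ z else 0)"
      by (auto simp: W_def)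
    have "(\<lambda>z. c * w z) = (\<lambda>z. if z \<in> Z then (c \<cdot>\<^sub>m A) $$ z else 0)"
      using Z T(1)[OF *(1)] by (auto simp: * fun_eq_iff)
    then show ?thesis unfolding W_def by (rule image_eqI) (rule T(4)[OF *(1)])
  qed
  have W4: "\<exists>z\<in>Z. w z \<noteq> u z" if "w \<in> W" for w
    using that u by (fastforce simp: W_def)
  obtain x where x: "\<And>w. w \<in> W \<Longrightarrow> (\<Sum>z\<in>Z. x z * w z) = 0" "(\<Sum>z\<in>Z. x z * u z) \<noteq> 0"
    using separating_functional[OF Zfin W1 W2 W3 W4] by blast
  show ?thesis
  proof (intro exI[of _ x] conjI ballI x(2))
    fix N assume "N \<in> T"
    then have "(\<lambda>z. if z \<in> Z then N $$ z else 0) \<in> W" by (auto simp: W_def)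
    from x(1)[OF this] show "(\<Sum>z\<in>Z. x z * N $$ z) = 0" by (simp cong: sum.cong)
  qed
qed

text \<open>If the prescription fails for every \<open>j\<close> in \<open>J\<close>, each failure
  yields a form on the rows \<open>j\<close> and \<open>k\<close> that vanishes on \<open>T\<close>
  but not at the target. These forms are independent, so there are more of them than
  \<open>m\<close> allows.\<close>

lemma prescribe_two_rows:
  fixes r :: "nat \<Rightarrow> nat \<Rightarrow> 'a::field"
  assumes T: "subspace_mat n p T" and I: "I \<subseteq> {..<n}" and C: "C \<subseteq> {..<p}"
    and J: "J \<subseteq> I" and k: "k \<in> I" and N\<^sub>0: "N\<^sub>0 \<in> T"
    and cd: "codim_le T (I \<times> C) m" "m < card J"
  shows "\<exists>j\<in>J. \<exists>N\<in>T. (\<forall>l\<in>C. N $$ (j, l) = r j l) \<and> (j \<noteq> k \<longrightarrow> (\<forall>l\<in>C. N $$ (k, l) = N\<^sub>0 $$ (k, l)))"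
proof (rule ccontr)
  assume "\<not> ?thesis"
  then have no: "\<not> ((\<forall>l\<in>C. N $$ (j, l) = r j l) \<and> (j \<noteq> k \<longrightarrow> (\<forall>l\<in>C. N $$ (k, l) = N\<^sub>0 $$ (k, l))))"
    if "j \<in> J" "N \<in> T" for j N
    using that by blast
  have fin: "finite I" "finite C" "finite J"
    using I C J by (meson finite_lessThan finite_subset)+
  define Z where "Z = (\<lambda>j. {j, k} \<times> C)"
  \<comment> \<open>For \<open>j = k\<close> the two clauses concern the same row and
    \<open>r\<close> takes precedence, in agreement with the guard \<open>j \<noteq> k\<close> of
    the statement.\<close>
  define u where "u = (\<lambda>j (i, l). if i = j then r j l else N\<^sub>0 $$ (k, l))"
  have "\<exists>x. (\<forall>N\<in>T. (\<Sum>z\<in>Z j. x z * N $$ z) = 0) \<and> (\<Sum>z\<in>Z j. x z * u j z) \<noteq> 0" if j: "j \<in> J" for j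
  proof -
    have Zj: "Z j \<subseteq> {..<n} \<times> {..<p}" using I C J k j by (auto simp: Z_def)
    have "\<exists>z\<in>Z j. N $$ z \<noteq> u j z" if "N \<in> T" for N
      using no[OF j that] by (fastforce simp: Z_def u_def)
    from separating_entries[OF T Zj this] show ?thesis .
  qed
  then obtain x where x: "\<And>j N. j \<in> J \<Longrightarrow> N \<in> T \<Longrightarrow> (\<Sum>z\<in>Z j. x j z * N $$ z) = 0"
    "\<And>j. j \<in> J \<Longrightarrow> (\<Sum>z\<in>Z j. x j z * u j z) \<noteq> 0" by metis
  define B where "B = (\<lambda>j z. if z \<in> Z j then x j z else 0)"
  have ann: "annihilates T (I \<times> C) (B j)" if "j \<in> J" for j
  proof (rule annihilates_mono)
    show "annihilates T (Z j) (B j)" unfolding B_def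
      by (rule annihilates_restrict) (rule x(1)[OF that])
  qed (use fin k J that in \<open>auto simp: Z_def\<close>)
  \<comment> \<open>A form without coefficients in row \<open>j\<close> sees only row
    \<open>k\<close>, where the target agrees with \<open>N\<^sub>0\<close>; as
    \<open>N\<^sub>0\<close> lies in \<open>T\<close>, the form could not reject the target.\<close>
  have nz: "\<exists>l\<in>C. x j (j, l) \<noteq> 0" if j: "j \<in> J" "j \<noteq> k" for j
  proof (rule ccontr)
    assume "\<not> ?thesis"
    then have "(\<Sum>z\<in>Z j. x j z * u j z) = (\<Sum>z\<in>Z j. x j z * N\<^sub>0 $$ z)"
      using j by (intro sum.cong) (auto simp: Z_def u_def)
    then show False using x(2)[OF j(1)] x(1)[OF j(1) N\<^sub>0] by simp
  qed
  have "indep_fam J B"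
    unfolding indep_fam_def
  proof (intro allI impI)
    fix a assume a: "\<forall>z. (\<Sum>j\<in>J. a j * B j z) = 0"
    \<comment> \<open>For \<open>j \<noteq> k\<close> no other form of the family meets row
      \<open>j\<close>. The index \<open>k\<close>, if it occurs, has to come last, because every
      form may meet row \<open>k\<close>.\<close>
    have aj: "a j = 0" if j: "j \<in> J" "j \<noteq> k" for j
    proof -
      obtain l where l: "l \<in> C" "x j (j, l) \<noteq> 0" using nz[OF j] by auto
      have "(\<Sum>i\<in>J. a i * B i (j, l)) = a j * B j (j, l)"
        by (rule sum.mono_neutral_cong_right[where S = "{j}", THEN trans])
          (use j fin in \<open>auto simp: B_def Z_def\<close>)
      moreover have "B j (j, l) \<noteq> 0" using l by (simp add: B_def Z_def)
      ultimately show ?thesis using a by (metis mult_eq_0_iff)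
    qed
    show "\<forall>j\<in>J. a j = 0"
    proof
      fix j assume j: "j \<in> J"
      show "a j = 0"
      proof (cases "j = k")
        case True
        obtain z where z: "z \<in> Z j" "x j z \<noteq> 0"
          using x(2)[OF j] by (rule sum.not_neutral_contains_not_neutral) auto
        have "(\<Sum>i\<in>J. a i * B i z) = a j * B j z"
          by (rule sum.mono_neutral_cong_right[where S = "{j}", THEN trans])
            (use j fin aj True in auto)
        moreover have "B j z \<noteq> 0" using z by (simp add: B_def)
        ultimately show ?thesis using a by (metis mult_eq_0_iff)
      qed (rule aj[OF j])
    qed
  qed
  from codim_leD[OF cd(1) fin(3) this ann] cd(2) show False by simp
qed

text \<open>Here \<open>f\<close> stands for one column of a map and \<open>rc\<close> for the
  inclusion of left kernels. Deleting a row met by an annihilating form lowers the number of rows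
  and the codimension together, so the bound \<open>card I - 2\<close> survives the induction on the
  number of rows. When no such form is left, all entries on \<open>I \<times> C\<close> are free and
  comparing two rows forces linearity.\<close>

lemma range_compatible_local:
  fixes f :: "'a::field mat \<Rightarrow> nat \<Rightarrow> 'a"
  assumes T: "subspace_mat n p T" and C: "C \<subseteq> {..<p}"
    and I: "I \<subseteq> {..<n}" "2 \<le> card I" and cd: "codim_le T (I \<times> C) (card I - 2)"
    and f: "\<And>A B i. A \<in> T \<Longrightarrow> B \<in> T \<Longrightarrow> i \<in> I \<Longrightarrow> f (A + B) i = f A i + f B i"
    and rc: "\<And>N y. N \<in> T \<Longrightarrow> (\<And>l. l \<in> C \<Longrightarrow> (\<Sum>i\<in>I. y i * N $$ (i, l)) = 0) \<Longrightarrow> (\<Sum>i\<in>I. y i * f N i) = 0"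
  shows "\<exists>x. \<forall>N\<in>T. \<forall>i\<in>I. f N i = (\<Sum>l\<in>C. N $$ (i, l) * x l)"
  using I cd f rc
proof (induction "card I" arbitrary: I rule: less_induct)
  case less
  note I = less.prems(1,2) and cd = less.prems(3) and f = less.prems(4) and rc = less.prems(5)
  note T' = subspace_matD[OF T]
  have fin: "finite I" "finite C" using I C by (meson finite_lessThan finite_subset)+
  have add: "(A + B) $$ (i, l) = A $$ (i, l) + B $$ (i, l)" "(c \<cdot>\<^sub>m A) $$ (i, l) = c * A $$ (i, l)"
    if "A \<in> T" "B \<in> T" "i \<in> I" "l \<in> C" for A B i l c
    using T'(1)[OF that(1)] T'(1)[OF that(2)] that I C by (auto simp: subset_eq)
  have rc1: "f N i = 0" if "N \<in> T" "i \<in> I" "\<And>l. l \<in> C \<Longrightarrow> N $$ (i, l) = 0" for N i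
  proof -
    have d: "(\<Sum>h\<in>I. (if h = i then 1 else 0) * g h) = g i" for g :: "nat \<Rightarrow> 'a"
      using that(2) fin by (simp add: if_distrib[of "\<lambda>x. x * _"] cong: if_cong)
    show ?thesis using rc[OF that(1), of "\<lambda>h. if h = i then 1 else 0"] that by (simp add: d)
  qed
  have rc2: "f N i + c * f N k = 0"
    if "N \<in> T" "i \<in> I" "k \<in> I" "\<And>l. l \<in> C \<Longrightarrow> N $$ (i, l) + c * N $$ (k, l) = 0" for N i k c
  proof -
    \<comment> \<open>The two indicators are added, not nested, so that the formula also covers
      \<open>i = k\<close>, where the coefficient is \<open>1 + c\<close>.\<close>
    have d: "(\<Sum>h\<in>I. ((if h = i then 1 else 0) + (if h = k then c else 0)) * g h) = g i + c * g k"
      for g :: "nat \<Rightarrow> 'a"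
      using that(2,3) fin
      by (simp add: distrib_right sum.distrib if_distrib[of "\<lambda>x. x * _"] cong: if_cong)
    show ?thesis
      using rc[OF that(1), of "\<lambda>h. (if h = i then 1 else 0) + (if h = k then c else 0)"] that
      by (simp add: d)
  qed
  have opp: "f N i = - f M i" if "N \<in> T" "M \<in> T" "i \<in> I" "\<And>l. l \<in> C \<Longrightarrow> N $$ (i, l) = - M $$ (i, l)" for N M i
  proof -
    have "f (N + M) i = 0"
      by (rule rc1) (use that T'(3) in \<open>auto simp: add\<close>)
    then show ?thesis using f[OF that(1-3)] by (simp add: eq_neg_iff_add_eq_0)
  qed
  have row_cong: "f N i = f M i" if "N \<in> T" "M \<in> T" "i \<in> I" "\<And>l. l \<in> C \<Longrightarrow> N $$ (i, l) = M $$ (i, l)" for N M i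
  proof -
    have "(- 1) \<cdot>\<^sub>m M \<in> T" by (rule T'(4)[OF that(2)])
    then show ?thesis
      using opp[OF that(1), of "(- 1) \<cdot>\<^sub>m M" i] opp[OF that(2), of "(- 1) \<cdot>\<^sub>m M" i] that
      by (auto simp: add)
  qed
  show ?case
  proof (cases "\<exists>B. annihilates T (I \<times> C) B \<and> (\<exists>z. B z \<noteq> 0)")
    case True
    then obtain B k l\<^sub>0 where B: "annihilates T (I \<times> C) B" "B (k, l\<^sub>0) \<noteq> 0" by auto
    then have k: "k \<in> I" unfolding annihilates_def by auto
    define I' where "I' = I - {k}"
    have card_I': "card I = Suc (card I')" using card_Suc_Diff1[OF fin(1) k] by (simp add: I'_def)
    have cdI': "codim_le T (I' \<times> C) (card I - 3)" and card3: "3 \<le> card I"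
    proof -
      \<comment> \<open>A family of forms on the remaining rows stays independent when
        \<open>B\<close> is added, since only \<open>B\<close> has a nonzero coefficient at the
        position \<open>(k, l\<^sub>0)\<close> of the deleted row.\<close>
      have *: "Suc (card J) \<le> card I - 2"
        if J: "finite J" "indep_fam J D" "\<And>j. j \<in> J \<Longrightarrow> annihilates T (I' \<times> C) (D j)" for J :: "nat set" and D
      proof -
        obtain m where m: "m \<notin> J" using J(1) infinite_UNIV_nat ex_new_if_finite by blast
        have D0: "D j (k, l\<^sub>0) = 0" if "j \<in> J" for j using J(3)[OF that] by (auto simp: annihilates_def I'_def)
        have "indep_fam (insert m J) (D(m := B))"
          unfolding indep_fam_def
        proof (intro allI impI)
          fix a assume "\<forall>z. (\<Sum>j\<in>insert m J. a j * (D(m := B)) j z) = 0"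
          moreover have "(\<Sum>j\<in>J. a j * (D(m := B)) j z) = (\<Sum>j\<in>J. a j * D j z)" for z
            by (rule sum.cong) (use m in auto)
          ultimately have s: "a m * B z + (\<Sum>j\<in>J. a j * D j z) = 0" for z
            using J(1) m by (cases z) simp
          have "a m = 0" using s[of "(k, l\<^sub>0)"] D0 B(2) by simp
          moreover from this have "\<forall>j\<in>J. a j = 0" using s indep_famD[OF J(2)] by auto
          ultimately show "\<forall>j\<in>insert m J. a j = 0" by auto
        qed
        moreover have "annihilates T (I \<times> C) ((D(m := B)) j)" if "j \<in> insert m J" for j
        proof (cases "j = m")
          case False
          then have "annihilates T (I' \<times> C) (D j)" using that J(3) by auto
          then have "annihilates T (I \<times> C) (D j)"
            by (rule annihilates_mono) (use fin in \<open>auto simp: I'_def\<close>)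
          then show ?thesis using False by simp
        qed (simp add: B(1))
        ultimately have "card (insert m J) \<le> card I - 2"
          by (intro codim_leD[OF cd]) (use J(1) in simp)
        then show ?thesis using J(1) m by simp
      qed
      show "codim_le T (I' \<times> C) (card I - 3)"
        unfolding codim_le_def
      proof (intro allI impI)
        fix J :: "nat set" and D :: "nat \<Rightarrow> nat \<times> nat \<Rightarrow> 'a"
        assume "finite J" "indep_fam J D" "\<forall>j\<in>J. annihilates T (I' \<times> C) (D j)"
        then have "Suc (card J) \<le> card I - 2" by (intro *) auto
        then show "card J \<le> card I - 3" by linarith
      qed
      \<comment> \<open>With the empty family, \<open>B\<close> alone uses up one of the
        \<open>card I - 2\<close> forms. So the truncated subtractions are exact and at least two
        rows remain for the induction hypothesis.\<close>
      show "3 \<le> card I" using *[of "{}"] by (simp add: indep_fam_def)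
    qed
    have "\<exists>x. \<forall>N\<in>T. \<forall>i\<in>I'. f N i = (\<Sum>l\<in>C. N $$ (i, l) * x l)"
    proof (rule less.hyps)
      show "card I' < card I" "I' \<subseteq> {..<n}" "2 \<le> card I'" using card_I' card3 I by (auto simp: I'_def)
      show "codim_le T (I' \<times> C) (card I' - 2)" using cdI' card_I' by (simp add: numeral_eq_Suc)
      show "\<And>A B i. A \<in> T \<Longrightarrow> B \<in> T \<Longrightarrow> i \<in> I' \<Longrightarrow> f (A + B) i = f A i + f B i" using f by (simp add: I'_def)
      fix N y assume N: "N \<in> T" "\<And>l. l \<in> C \<Longrightarrow> (\<Sum>i\<in>I'. y i * N $$ (i, l)) = 0"
      have d: "(\<Sum>i\<in>I. (if i = k then 0 else y i) * g i) = (\<Sum>i\<in>I'. y i * g i)" for g :: "nat \<Rightarrow> 'a"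
        by (rule sum.mono_neutral_cong_right) (use fin in \<open>auto simp: I'_def\<close>)
      show "(\<Sum>i\<in>I'. y i * f N i) = 0"
        using rc[OF N(1), of "\<lambda>i. if i = k then 0 else y i"] N(2) by (simp add: d)
    qed
    then obtain x where x: "\<And>N i. N \<in> T \<Longrightarrow> i \<in> I' \<Longrightarrow> f N i = (\<Sum>l\<in>C. N $$ (i, l) * x l)" by blast
    have "f N k = (\<Sum>l\<in>C. N $$ (k, l) * x l)" if N: "N \<in> T" for N
    proof -
      \<comment> \<open>The rows of \<open>I'\<close> outnumber the available forms by one. In the
        matrix obtained, row \<open>j\<close> is opposite to row \<open>k\<close>, and row
        \<open>k\<close> is that of \<open>N\<close>; the sum of the two rows vanishes, which
        transfers the formula for \<open>f\<close> from row \<open>j\<close> to row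
        \<open>k\<close>.\<close>
      have "card I - 2 < card I'" using card_I' card3 by simp
      then obtain j M where M: "j \<in> I'" "M \<in> T" "\<And>l. l \<in> C \<Longrightarrow> M $$ (j, l) = - N $$ (k, l)"
        "\<And>l. j \<noteq> k \<Longrightarrow> l \<in> C \<Longrightarrow> M $$ (k, l) = N $$ (k, l)"
        using prescribe_two_rows[OF T I(1) C _ k N cd, of I' "\<lambda>j l. - N $$ (k, l)"]
        unfolding I'_def by blast
      have jk: "j \<noteq> k" "j \<in> I" using M(1) by (auto simp: I'_def)
      have "f M j + 1 * f M k = 0"
        by (rule rc2) (use M jk k in auto)
      moreover have "f M k = f N k" by (rule row_cong) (use M N k jk in auto)
      moreover have "f M j = - (\<Sum>l\<in>C. N $$ (k, l) * x l)"
        using x[OF M(2,1)] M(3) by (simp add: sum_negf)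
      ultimately show ?thesis by simp
    qed
    then show ?thesis using x by (metis I'_def DiffI singletonD)
  next
    case False
    have ex: "\<exists>N\<in>T. \<forall>i\<in>I. \<forall>l\<in>C. N $$ (i, l) = u i l" for u
    proof (rule ccontr)
      assume "\<not> ?thesis"
      then have no: "\<exists>z\<in>I \<times> C. N $$ z \<noteq> (case z of (i, l) \<Rightarrow> u i l)" if "N \<in> T" for N
        using that by fastforce
      have Z: "I \<times> C \<subseteq> {..<n} \<times> {..<p}" using I C by auto
      obtain x where x: "\<And>N. N \<in> T \<Longrightarrow> (\<Sum>z\<in>I \<times> C. x z * N $$ z) = 0"
        "(\<Sum>z\<in>I \<times> C. x z * (case z of (i, l) \<Rightarrow> u i l)) \<noteq> 0"
        using separating_entries[OF T Z no] by blast
      from x(2) obtain z where "z \<in> I \<times> C" "x z \<noteq> 0"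
        by (rule sum.not_neutral_contains_not_neutral) auto
      moreover have "annihilates T (I \<times> C) (\<lambda>z. if z \<in> I \<times> C then x z else 0)"
        by (rule annihilates_restrict) (rule x(1))
      ultimately have "\<exists>B. annihilates T (I \<times> C) B \<and> (\<exists>z. B z \<noteq> 0)"
        by (intro exI[of _ "\<lambda>z. if z \<in> I \<times> C then x z else 0"]) auto
      then show False using False by contradiction
    qed
    have row_scale_ne: "f N i = c * f M k" if "N \<in> T" "M \<in> T" "i \<in> I" "k \<in> I" "i \<noteq> k"
      "\<And>l. l \<in> C \<Longrightarrow> N $$ (i, l) = c * M $$ (k, l)" for N M i k c
    proof -
      \<comment> \<open>Row \<open>i\<close> of \<open>L\<close> plus \<open>c\<close> times row
        \<open>k\<close> vanishes. This is the source of homogeneity: it gives the behaviour of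
        \<open>f\<close> under scalars and shows that its value depends on the row vector only, not
        on the row number.\<close>
      obtain L where L: "L \<in> T" "\<And>h l. h \<in> I \<Longrightarrow> l \<in> C \<Longrightarrow> L $$ (h, l) = (if h = i then N $$ (i, l) else - M $$ (k, l))"
        using ex[of "\<lambda>h l. if h = i then N $$ (i, l) else - M $$ (k, l)"] by auto
      have "f L i + c * f L k = 0" by (rule rc2) (use L that in auto)
      moreover have "f L i = f N i" by (rule row_cong) (use L that in auto)
      moreover have "f L k = - f M k" by (rule opp) (use L that in auto)
      ultimately show ?thesis by simp
    qed
    have row_scale: "f N i = c * f M k" if h: "N \<in> T" "M \<in> T" "i \<in> I" "k \<in> I"
      "\<And>l. l \<in> C \<Longrightarrow> N $$ (i, l) = c * M $$ (k, l)" for N M i k c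
    proof (cases "i = k")
      case True
      \<comment> \<open>A scalar within one row is reached by a detour through a second row; with a
        single row, an arbitrary additive map would remain possible.\<close>
      obtain j where j: "j \<in> I" "j \<noteq> k"
        using I(2) fin by (metis card_le_Suc0_iff_eq not_less_eq_eq numeral_2_eq_2)
      obtain L where L: "L \<in> T" "\<And>h l. h \<in> I \<Longrightarrow> l \<in> C \<Longrightarrow> L $$ (h, l) = M $$ (k, l)"
        using ex[of "\<lambda>h l. M $$ (k, l)"] by auto
      have "f N i = c * f L j" by (rule row_scale_ne) (use L h j True in auto)
      moreover have "f L j = 1 * f M k" by (rule row_scale_ne) (use L h j True in auto)
      ultimately show ?thesis by simp
    qed (use row_scale_ne h in blast)
    obtain i\<^sub>0 where i0: "i\<^sub>0 \<in> I" using I(2) by fastforce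
    have "\<exists>N\<in>T. \<forall>i\<in>I. \<forall>l'\<in>C. N $$ (i, l') = (if l' = l then 1 else 0)" for l by (rule ex)
    then obtain E where E: "\<And>l. E l \<in> T"
      "\<And>l i l'. i \<in> I \<Longrightarrow> l' \<in> C \<Longrightarrow> E l $$ (i, l') = (if l' = l then 1 else 0)"
      by metis
    define x where "x = (\<lambda>l. f (E l) i\<^sub>0)"
    \<comment> \<open>Additivity and the scalar rule let the columns be peeled off one at a time, so
      the induction is on a set \<open>D\<close> of columns that contains the support of row
      \<open>i\<^sub>0\<close>.\<close>
    have main: "f N i\<^sub>0 = (\<Sum>l\<in>D. N $$ (i\<^sub>0, l) * x l)"
      if "finite D" "D \<subseteq> C" "N \<in> T" "\<And>l. l \<in> C - D \<Longrightarrow> N $$ (i\<^sub>0, l) = 0" for D N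
      using that
    proof (induction D arbitrary: N rule: finite_induct)
      case empty
      then show ?case using rc1[of N i\<^sub>0] i0 by simp
    next
      case (insert l D)
      obtain M where M: "M \<in> T" "\<And>h l'. h \<in> I \<Longrightarrow> l' \<in> C \<Longrightarrow> M $$ (h, l') = (if l' = l then 0 else N $$ (i\<^sub>0, l'))"
        using ex[of "\<lambda>h l'. if l' = l then 0 else N $$ (i\<^sub>0, l')"] by auto
      let ?E = "N $$ (i\<^sub>0, l) \<cdot>\<^sub>m E l"
      have ET: "?E \<in> T" by (rule T'(4)[OF E(1)])
      have "f N i\<^sub>0 = f (M + ?E) i\<^sub>0"
        by (rule row_cong) (use insert M ET E i0 T'(3) in \<open>auto simp: add\<close>)
      also have "\<dots> = f M i\<^sub>0 + f ?E i\<^sub>0" by (rule f[OF M(1) ET i0])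
      also have "f ?E i\<^sub>0 = N $$ (i\<^sub>0, l) * x l"
        unfolding x_def by (rule row_scale) (use E ET i0 in \<open>auto simp: add\<close>)
      also have "f M i\<^sub>0 = (\<Sum>l'\<in>D. M $$ (i\<^sub>0, l') * x l')"
        by (rule insert.IH) (use insert M i0 in auto)
      also have "\<dots> = (\<Sum>l'\<in>D. N $$ (i\<^sub>0, l') * x l')"
      proof (rule sum.cong)
        fix l' assume "l' \<in> D"
        then have "l' \<in> C" "l' \<noteq> l" using insert.hyps(2) insert.prems(1) by auto
        then show "M $$ (i\<^sub>0, l') * x l' = N $$ (i\<^sub>0, l') * x l'" using M(2)[OF i0] by simp
      qed simp
      finally show ?case using insert by (simp add: add.commute)
    qed
    have "f N i = (\<Sum>l\<in>C. N $$ (i, l) * x l)" if N: "N \<in> T" "i \<in> I" for N i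
    proof -
      obtain M where M: "M \<in> T" "\<And>h l. h \<in> I \<Longrightarrow> l \<in> C \<Longrightarrow> M $$ (h, l) = N $$ (i, l)"
        using ex[of "\<lambda>h l. N $$ (i, l)"] by auto
      have "f N i = 1 * f M i\<^sub>0" by (rule row_scale) (use M N i0 in auto)
      also have "\<dots> = (\<Sum>l\<in>C. N $$ (i, l) * x l)"
        using main[OF fin(2) _ M(1)] M(2) i0 by simp
      finally show ?thesis .
    qed
    then show ?thesis by blast
  qed
qed

subsection \<open>Codimension, column spaces and completion to invertible matrices\<close>

lemma lincomb_mat_index:
  assumes "length cs = length Ms" "set Ms \<subseteq> carrier_mat n p"
  shows "lincomb_mat n p cs Ms \<in> carrier_mat n p \<and>
    (\<forall>i<n. \<forall>j<p. lincomb_mat n p cs Ms $$ (i, j) = (\<Sum>k<length Ms. cs ! k * (Ms ! k) $$ (i, j)))"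
  using assms
proof (induction cs Ms rule: list_induct2)
  case Nil
  then show ?case by (simp add: lincomb_mat_def)
next
  case (Cons c cs M Ms)
  have "lincomb_mat n p (c # cs) (M # Ms) = c \<cdot>\<^sub>m M + lincomb_mat n p cs Ms"
    by (simp add: lincomb_mat_def)
  then show ?case using Cons by (auto simp: sum.lessThan_Suc_shift simp del: sum.lessThan_Suc)
qed

text \<open>Entries outside the block are cut to 0 because a matrix has unspecified values there,
  which would spoil the finite support.\<close>

lemma lin_indep_mat_indep_fam:
  assumes "lin_indep_mat n p Ms"
  shows "indep_fam {..<length Ms} (\<lambda>k z. if z \<in> {..<n} \<times> {..<p} then (Ms ! k) $$ z else 0)"
  unfolding indep_fam_def
proof (intro allI impI)
  fix a :: "nat \<Rightarrow> 'a"
  assume a: "\<forall>z. (\<Sum>k<length Ms. a k * (if z \<in> {..<n} \<times> {..<p} then (Ms ! k) $$ z else 0)) = 0"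
  let ?cs = "map a [0..<length Ms]"
  have Ms: "set Ms \<subseteq> carrier_mat n p" using assms by (simp add: lin_indep_mat_def)
  have idx: "lincomb_mat n p ?cs Ms \<in> carrier_mat n p"
    "\<And>i j. i < n \<Longrightarrow> j < p \<Longrightarrow>
       lincomb_mat n p ?cs Ms $$ (i, j) = (\<Sum>k<length Ms. ?cs ! k * (Ms ! k) $$ (i, j))"
    using lincomb_mat_index[OF _ Ms, of ?cs] by auto
  have "lincomb_mat n p ?cs Ms = 0\<^sub>m n p"
  proof (rule eq_matI)
    fix i j assume "i < dim_row (0\<^sub>m n p :: 'a mat)" "j < dim_col (0\<^sub>m n p :: 'a mat)"
    then have ij: "i < n" "j < p" by auto
    have "(\<Sum>k<length Ms. ?cs ! k * (Ms ! k) $$ (i, j)) = (\<Sum>k<length Ms. a k * (Ms ! k) $$ (i, j))"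
      by (rule sum.cong) auto
    then show "lincomb_mat n p ?cs Ms $$ (i, j) = 0\<^sub>m n p $$ (i, j)"
      using idx(2)[OF ij] a[rule_format, of "(i, j)"] ij by simp
  qed (use idx in auto)
  then have "\<forall>c\<in>set ?cs. c = 0"
    using assms unfolding lin_indep_mat_def by (metis diff_zero length_map length_upt)
  then show "\<forall>k\<in>{..<length Ms}. a k = 0" by auto
qed

text \<open>\<open>Max\<close> is meaningful only on a finite nonempty set: lengths of independent
  lists are bounded by the number of entries, and the empty list is independent.\<close>

lemma dim_mat_space_attained:
  fixes S :: "'a::field mat set"
  obtains Ms where "set Ms \<subseteq> S" "lin_indep_mat n p Ms" "length Ms = dim_mat_space n p S"
proof -
  let ?L = "{length Ms | Ms. set Ms \<subseteq> S \<and> lin_indep_mat n p Ms}"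
  have "length Ms \<le> card ({..<n} \<times> {..<p})" if "lin_indep_mat n p Ms" for Ms :: "'a mat list"
    using indep_fam_card_le[OF _ lin_indep_mat_indep_fam[OF that], of "{..<n} \<times> {..<p}"] by simp
  then have "?L \<subseteq> {..card ({..<n} \<times> {..<p})}" by auto
  then have "finite ?L" by (rule finite_subset) simp
  moreover have "lin_indep_mat n p ([] :: 'a mat list)" by (simp add: lin_indep_mat_def)
  then have "length ([] :: 'a mat list) \<in> ?L" by (intro CollectI exI[of _ "[]"]) auto
  then have "?L \<noteq> {}" by blast
  ultimately have "Max ?L \<in> ?L" by (rule Max_in)
  then obtain Ms where "set Ms \<subseteq> S" "lin_indep_mat n p Ms" "length Ms = Max ?L" by auto
  then show thesis using that unfolding dim_mat_space_def by simp
qed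

text \<open>Annihilating forms are orthogonal to an independent list of maximal length, so the two
  counts add up to at most \<open>n * p\<close>.\<close>

lemma codim_le_codim_mat_space:
  "codim_le S ({..<n} \<times> {..<p}) (codim_mat_space n p S)"
  unfolding codim_le_def
proof (intro allI impI)
  fix J :: "nat set" and B :: "nat \<Rightarrow> nat \<times> nat \<Rightarrow> 'a"
  assume J: "finite J" "indep_fam J B" "\<forall>j\<in>J. annihilates S ({..<n} \<times> {..<p}) (B j)"
  let ?Z = "{..<n} \<times> {..<p}"
  obtain Ms where Ms: "set Ms \<subseteq> S" "lin_indep_mat n p Ms" "length Ms = dim_mat_space n p S"
    by (rule dim_mat_space_attained)
  have "card J + card {..<length Ms} \<le> card ?Z"
  proof (rule card_orthogonal_indep_fams[OF J(1,2) _ _ lin_indep_mat_indep_fam[OF Ms(2)]])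
    fix j k assume jk: "j \<in> J" "k \<in> {..<length Ms}"
    have "(\<Sum>z\<in>?Z. B j z * (if z \<in> ?Z then (Ms ! k) $$ z else 0)) = (\<Sum>z\<in>?Z. B j z * (Ms ! k) $$ z)"
      by (rule sum.cong) auto
    also have "\<dots> = 0" using J(3) jk Ms(1) nth_mem[of k Ms] unfolding annihilates_def by blast
    finally show "(\<Sum>z\<in>?Z. B j z * (if z \<in> ?Z then (Ms ! k) $$ z else 0)) = 0" .
  qed (use J(3) in \<open>auto simp: annihilates_def\<close>)
  then show "card J \<le> codim_mat_space n p S"
    using Ms(3) by (simp add: codim_mat_space_def card_cartesian_product)
qed

text \<open>A form \<open>B j\<close> on the smaller space has the value \<open>b j\<close> at
  \<open>M\<^sub>1\<close>, and \<open>S\<close> consists of that space plus the multiples of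
  \<open>M\<^sub>1\<close>. Subtracting \<open>b j\<close> times the entry \<open>(0, 0)\<close>
  therefore gives a form that vanishes on all of \<open>S\<close>. Together with the
  \<open>n - 1\<close> zero entries of the first column these forms are independent, which leaves at
  most \<open>m\<close> for \<open>B\<close>.\<close>

lemma codim_le_first_column_zero:
  fixes S :: "'a::field mat set"
  assumes S: "subspace_mat n p S"
    and shape: "\<forall>M\<in>S. \<forall>i. 1 \<le> i \<and> i < n \<longrightarrow> M $$ (i, 0) = 0"
    and cd: "codim_le S ({..<n} \<times> {..<p}) (m + (n - 1))"
    and np: "0 < n" "0 < p" and M\<^sub>1: "M\<^sub>1 \<in> S" "M\<^sub>1 $$ (0, 0) = 1"
  shows "codim_le {M \<in> S. M $$ (0, 0) = 0} ({..<n} \<times> {1..<p}) m"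
  unfolding codim_le_def
proof (intro allI impI)
  let ?Z = "{..<n} \<times> {..<p}" and ?Z' = "{..<n} \<times> {1..<p}" and ?S\<^sub>0 = "{M \<in> S. M $$ (0, 0) = 0}"
  fix J :: "nat set" and B :: "nat \<Rightarrow> nat \<times> nat \<Rightarrow> 'a"
  assume J: "finite J" "indep_fam J B" "\<forall>j\<in>J. annihilates ?S\<^sub>0 ?Z' (B j)"
  note S' = subspace_matD[OF S]
  define b where "b = (\<lambda>j. \<Sum>z\<in>?Z'. B j z * M\<^sub>1 $$ z)"
  \<comment> \<open>Indices below \<open>n\<close> name entries of the first column; the family
    \<open>B\<close> is shifted by \<open>n\<close> to keep the two kinds apart. Index 0 is left
    out, as the entry \<open>(0, 0)\<close> does not vanish on \<open>S\<close>.\<close>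
  define J' where "J' = {1..<n} \<union> (+) n ` J"
  define D where "D = (\<lambda>j. if j < n then unit_fun (j, 0)
    else (\<lambda>z. B (j - n) z - b (j - n) * unit_fun (0, 0) z))"
  have B0: "B j (i, 0) = 0" if "j \<in> J" for i j
    using J(3) that by (auto simp: annihilates_def)
  have sum_unit: "(\<Sum>z\<in>?Z. unit_fun (i, 0) z * M $$ z) = M $$ (i, 0)" if "i < n" for i and M :: "'a mat"
  proof -
    have "(\<Sum>z\<in>?Z. unit_fun (i, 0) z * M $$ z) = (\<Sum>z\<in>?Z. if z = (i, 0) then M $$ (i, 0) else 0)"
      by (rule sum.cong) (auto simp: unit_fun_def)
    then show ?thesis using that np by simp
  qed
  have sum_B: "(\<Sum>z\<in>?Z. B j z * M $$ z) = (\<Sum>z\<in>?Z'. B j z * M $$ z)" if "j \<in> J" for j and M :: "'a mat"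
  proof (rule sum.mono_neutral_right)
    have "\<And>z. z \<notin> ?Z' \<Longrightarrow> B j z = 0" using J(3) that unfolding annihilates_def by blast
    then show "\<forall>z\<in>?Z - ?Z'. B j z * M $$ z = 0" by (metis DiffD2 mult_zero_left)
  qed auto
  have annB: "(\<Sum>z\<in>?Z'. B j z * M $$ z) = M $$ (0, 0) * b j" if j: "j \<in> J" and M: "M \<in> S" for j M
  proof -
    let ?M = "M + (- M $$ (0, 0)) \<cdot>\<^sub>m M\<^sub>1"
    have c: "M \<in> carrier_mat n p" "M\<^sub>1 \<in> carrier_mat n p" using S' M M\<^sub>1 by auto
    have "?M \<in> S" using S' M M\<^sub>1 by blast
    moreover have "?M $$ (0, 0) = 0" using carrier_matD[OF c(1)] carrier_matD[OF c(2)] np M\<^sub>1 by simp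
    ultimately have "?M \<in> ?S\<^sub>0" by blast
    then have "(\<Sum>z\<in>?Z'. B j z * ?M $$ z) = 0" using J(3) j by (auto simp: annihilates_def)
    moreover have "(\<Sum>z\<in>?Z'. B j z * ?M $$ z)
        = (\<Sum>z\<in>?Z'. B j z * M $$ z - M $$ (0, 0) * (B j z * M\<^sub>1 $$ z))"
      by (rule sum.cong) (use c in \<open>auto simp: algebra_simps\<close>)
    ultimately show ?thesis by (simp add: sum_subtractf b_def sum_distrib_left)
  qed
  have "annihilates S ?Z (D j)" if "j \<in> J'" for j
  proof (cases "j < n")
    case True
    then have "1 \<le> j" using that by (auto simp: J'_def)
    moreover have "unit_fun (j, 0) z = (0 :: 'a)" if "z \<notin> ?Z" for z
      using that True np by (auto simp: unit_fun_def)
    ultimately show ?thesis using True shape sum_unit[OF True] by (simp add: annihilates_def D_def)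
  next
    case False
    then have "j \<in> (+) n ` J" using that by (auto simp: J'_def)
    then obtain h where h: "h \<in> J" "j = n + h" by blast
    have "(\<Sum>z\<in>?Z. (B h z - b h * unit_fun (0, 0) z) * M $$ z) = 0" if "M \<in> S" for M
    proof -
      have "(\<Sum>z\<in>?Z. (B h z - b h * unit_fun (0, 0) z) * M $$ z)
        = (\<Sum>z\<in>?Z. B h z * M $$ z) - b h * (\<Sum>z\<in>?Z. unit_fun (0, 0) z * M $$ z)"
        by (simp add: left_diff_distrib sum_subtractf sum_distrib_left mult.assoc)
      then show ?thesis using sum_B[OF h(1)] annB[OF h(1) that] sum_unit[OF np(1)] by simp
    qed
    moreover have "B h z - b h * unit_fun (0, 0) z = 0" if "z \<notin> ?Z" for z
    proof -
      have "z \<notin> ?Z'" using that by auto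
      then have "B h z = 0" using J(3) h(1) unfolding annihilates_def by blast
      then show ?thesis using that np by (auto simp: unit_fun_def)
    qed
    ultimately show ?thesis unfolding annihilates_def D_def using h by simp
  qed
  moreover have "indep_fam J' D"
    unfolding indep_fam_def
  proof (intro allI impI)
    fix a assume "\<forall>z. (\<Sum>j\<in>J'. a j * D j z) = 0"
    moreover have "(\<Sum>j\<in>J'. a j * D j z) = (\<Sum>i\<in>{1..<n}. a i * unit_fun (i, 0) z)
      + (\<Sum>j\<in>J. a (n + j) * (B j z - b j * unit_fun (0, 0) z))" for z
    proof -
      have "(\<Sum>j\<in>J'. a j * D j z) = (\<Sum>j\<in>{1..<n}. a j * D j z) + (\<Sum>j\<in>(+) n ` J. a j * D j z)"
        unfolding J'_def by (rule sum.union_disjoint) (use J in auto)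
      also have "(\<Sum>j\<in>{1..<n}. a j * D j z) = (\<Sum>i\<in>{1..<n}. a i * unit_fun (i, 0) z)"
        by (rule sum.cong) (auto simp: D_def)
      also have "(\<Sum>j\<in>(+) n ` J. a j * D j z) = (\<Sum>j\<in>J. a (n + j) * (B j z - b j * unit_fun (0, 0) z))"
        by (subst sum.reindex) (auto simp: D_def)
      finally show ?thesis .
    qed
    ultimately have s: "(\<Sum>i\<in>{1..<n}. a i * unit_fun (i, 0) z)
      + (\<Sum>j\<in>J. a (n + j) * (B j z - b j * unit_fun (0, 0) z)) = 0" for z by metis
    have a1: "a i = 0" if i: "i \<in> {1..<n}" for i
    proof -
      have "(\<Sum>h\<in>{1..<n}. a h * unit_fun (h, 0 :: nat) (i, 0)) = (\<Sum>h\<in>{1..<n}. if h = i then a i else 0)"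
        by (rule sum.cong) (auto simp: unit_fun_def)
      moreover have "(\<Sum>j\<in>J. a (n + j) * (B j (i, 0) - b j * unit_fun (0, 0) (i, 0 :: nat))) = 0"
        by (rule sum.neutral) (use B0 i in \<open>auto simp: unit_fun_def\<close>)
      ultimately show ?thesis using s[of "(i, 0)"] i by simp
    qed
    have "(\<Sum>j\<in>J. a (n + j) * B j z) = 0" for z
    proof (cases "snd z = 0")
      case True
      then show ?thesis using B0 by (cases z) simp
    next
      case False
      then show ?thesis using s[of z] a1 by (cases z) (auto simp: unit_fun_def)
    qed
    from indep_famD[OF J(2) this] a1 show "\<forall>j\<in>J'. a j = 0" by (auto simp: J'_def)
  qed
  moreover have "finite J'" using J(1) by (simp add: J'_def)
  ultimately have "card J' \<le> m + (n - 1)" using codim_leD[OF cd] by blast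
  moreover have "card J' = (n - 1) + card J"
    unfolding J'_def using J(1) by (subst card_Un_disjoint) (auto simp: card_image)
  ultimately show "card J \<le> m" by simp
qed

section \<open>Left kernels and column spaces\<close>

definition left_ker :: "'a::field mat \<Rightarrow> (nat \<Rightarrow> 'a) \<Rightarrow> bool" where
  "left_ker A y \<longleftrightarrow> (\<forall>j<dim_col A. (\<Sum>i<dim_row A. y i * A $$ (i, j)) = 0)"

lemma left_ker_mult:
  assumes "A \<in> carrier_mat n p" "B \<in> carrier_mat p q" "left_ker A y"
  shows "left_ker (A * B) y"
  unfolding left_ker_def
proof (intro allI impI)
  fix j assume "j < dim_col (A * B)"
  then have j: "j < q" using assms by simp
  have "(\<Sum>i<n. y i * (A * B) $$ (i, j)) = (\<Sum>i<n. \<Sum>t<p. y i * A $$ (i, t) * B $$ (t, j))"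
    using assms j by (intro sum.cong)
      (auto simp: scalar_prod_def sum_distrib_left lessThan_atLeast0 mult.assoc)
  also have "\<dots> = (\<Sum>t<p. (\<Sum>i<n. y i * A $$ (i, t)) * B $$ (t, j))"
    by (subst sum.swap) (simp add: sum_distrib_right)
  also have "\<dots> = 0" using assms by (auto simp: left_ker_def)
  finally show "(\<Sum>i<dim_row (A * B). y i * (A * B) $$ (i, j)) = 0" using assms by simp
qed

lemma mult_mat_vec_index_sum:
  "B \<in> carrier_mat n q \<Longrightarrow> w \<in> carrier_vec q \<Longrightarrow> i < n \<Longrightarrow>
    (B *\<^sub>v w) $ i = (\<Sum>t<q. B $$ (i, t) * w $ t)"
  by (auto simp: scalar_prod_def lessThan_atLeast0)

lemma left_ker_mult_mat_vec:
  assumes "B \<in> carrier_mat n q" "w \<in> carrier_vec q" "left_ker B y"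
  shows "(\<Sum>i<n. y i * (B *\<^sub>v w) $ i) = 0"
proof -
  have "(\<Sum>i<n. y i * (B *\<^sub>v w) $ i) = (\<Sum>i<n. \<Sum>t<q. y i * B $$ (i, t) * w $ t)"
    using assms by (simp add: mult_mat_vec_index_sum sum_distrib_left mult.assoc del: index_mult_mat_vec)
  also have "\<dots> = (\<Sum>t<q. (\<Sum>i<n. y i * B $$ (i, t)) * w $ t)"
    by (subst sum.swap) (simp add: sum_distrib_right)
  also have "\<dots> = 0" using assms by (auto simp: left_ker_def)
  finally show ?thesis .
qed

text \<open>For the converse, a vector \<open>u\<close> outside the column space of \<open>B\<close>
  is rejected by a form that vanishes on that space. This form is in the left kernel of
  \<open>B\<close>, hence in that of \<open>A\<close>, and so vanishes at
  \<open>u = A *\<^sub>v v\<close>.\<close>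

lemma col_space_subset_iff_left_ker:
  assumes A: "A \<in> carrier_mat n p" and B: "(B :: 'a::field mat) \<in> carrier_mat n q"
  shows "col_space A \<subseteq> col_space B \<longleftrightarrow> (\<forall>y. left_ker B y \<longrightarrow> left_ker A y)"
proof
  assume sub: "col_space A \<subseteq> col_space B"
  show "\<forall>y. left_ker B y \<longrightarrow> left_ker A y"
  proof (intro allI impI)
    fix y assume y: "left_ker B y"
    show "left_ker A y"
      unfolding left_ker_def
    proof (intro allI impI)
      fix j assume "j < dim_col A"
      then have j: "j < p" using A by simp
      have "A *\<^sub>v unit_vec p j \<in> col_space A" using A unfolding col_space_def
        by (intro CollectI exI[of _ "unit_vec p j"]) auto
      then obtain w where w: "w \<in> carrier_vec q" "A *\<^sub>v unit_vec p j = B *\<^sub>v w"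
        using sub B unfolding col_space_def by auto
      have "A $$ (i, j) = (B *\<^sub>v w) $ i" if "i < n" for i
        unfolding w(2)[symmetric] using A j that by simp
      then have "(\<Sum>i<n. y i * A $$ (i, j)) = (\<Sum>i<n. y i * (B *\<^sub>v w) $ i)"
        by (intro sum.cong) auto
      then show "(\<Sum>i<dim_row A. y i * A $$ (i, j)) = 0"
        using left_ker_mult_mat_vec[OF B w(1) y] A by simp
    qed
  qed
next
  assume ker: "\<forall>y. left_ker B y \<longrightarrow> left_ker A y"
  show "col_space A \<subseteq> col_space B"
  proof
    fix u assume "u \<in> col_space A"
    then obtain v where v: "v \<in> carrier_vec p" "u = A *\<^sub>v v" using A by (auto simp: col_space_def)
    define W where "W = range (\<lambda>w i. \<Sum>t<q. B $$ (i, t) * w t)"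
    have "\<exists>w\<in>W. \<forall>i\<in>{..<n}. w i = u $ i"
    proof (rule ccontr)
      assume "\<not> ?thesis"
      then have no: "\<exists>i\<in>{..<n}. w i \<noteq> u $ i" if "w \<in> W" for w using that by blast
      have W1: "W \<noteq> {}" by (simp add: W_def)
      have W2: "(\<lambda>i. a i + b i) \<in> W" if "a \<in> W" "b \<in> W" for a b
      proof -
        from that obtain v w where "a = (\<lambda>i. \<Sum>t<q. B $$ (i, t) * v t)" "b = (\<lambda>i. \<Sum>t<q. B $$ (i, t) * w t)"
          by (auto simp: W_def)
        then have "(\<lambda>i. a i + b i) = (\<lambda>i. \<Sum>t<q. B $$ (i, t) * (v t + w t))"
          by (simp add: sum.distrib distrib_left)
        then show ?thesis unfolding W_def by (rule range_eqI[where x = "\<lambda>t. v t + w t"])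
      qed
      have W3: "(\<lambda>i. c * a i) \<in> W" if "a \<in> W" for c a
      proof -
        from that obtain w where "a = (\<lambda>i. \<Sum>t<q. B $$ (i, t) * w t)"
          by (auto simp: W_def)
        then have "(\<lambda>i. c * a i) = (\<lambda>i. \<Sum>t<q. B $$ (i, t) * (c * w t))"
          by (simp add: sum_distrib_left mult.left_commute)
        then show ?thesis unfolding W_def by (rule range_eqI[where x = "\<lambda>t. c * w t"])
      qed
      obtain x where x: "\<And>w. w \<in> W \<Longrightarrow> (\<Sum>i<n. x i * w i) = 0" "(\<Sum>i<n. x i * u $ i) \<noteq> 0"
        using separating_functional[OF finite_lessThan W1 W2 W3 no] by blast
      have "left_ker B x"
        unfolding left_ker_def
      proof (intro allI impI)
        fix j assume "j < dim_col B"
        then have "(\<Sum>t<q. B $$ (i, t) * unit_fun j t) = B $$ (i, j)" for i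
          using B by (simp add: unit_fun_def if_distrib cong: if_cong)
        moreover have "(\<lambda>i. \<Sum>t<q. B $$ (i, t) * unit_fun j t) \<in> W" unfolding W_def by blast
        ultimately show "(\<Sum>i<dim_row B. x i * B $$ (i, j)) = 0" using x(1) B by fastforce
      qed
      then show False using ker x(2) left_ker_mult_mat_vec[OF A v(1)] v(2) by blast
    qed
    then obtain w where w: "\<forall>i<n. (\<Sum>t<q. B $$ (i, t) * w t) = u $ i" unfolding W_def by blast
    have "u = B *\<^sub>v vec q w"
      by (rule eq_vecI) (use w A B v in \<open>auto simp: mult_mat_vec_index_sum[OF B] simp del: index_mult_mat_vec\<close>)
    then show "u \<in> col_space B" using B unfolding col_space_def
      by (intro CollectI exI[of _ "vec q w"]) auto
  qed
qed

text \<open>The given vectors become the last rows of \<open>Q\<close>, because the block form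
  multiplies its first columns by the free rows and its last \<open>p - 1\<close> columns by the
  prescribed ones.\<close>

lemma complete_rows_to_invertible:
  fixes v :: "nat \<Rightarrow> nat \<Rightarrow> 'a::field"
  assumes "indep_fam {..<m} v" "\<And>j t. j < m \<Longrightarrow> q \<le> t \<Longrightarrow> v j t = 0"
  shows "m \<le> q \<and> (\<exists>Q. Q \<in> carrier_mat q q \<and> invertible_mat Q \<and>
    (\<forall>j<m. \<forall>t<q. Q $$ (q - m + j, t) = v j t))"
proof -
  have mq: "m \<le> q"
    using indep_fam_card_le[OF _ assms(1), of "{..<q}"] assms(2) by simp
  let ?U = "unit_fun ` {..<q} :: (nat \<Rightarrow> 'a) set" and ?V = "v ` {..<m}"
  have inj: "inj_on v {..<m}" by (rule indep_fam_inj_on[OF _ assms(1)]) simp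
  \<comment> \<open>A maximal independent set between the given vectors and their union with the
    unit vectors is a basis of the vectors supported on \<open>{..<q}\<close>; it consists of
    \<open>q\<close> vectors, which are then listed with the given ones last.\<close>
  obtain R where R: "?V \<subseteq> R" "R \<subseteq> ?V \<union> ?U" "fun_vs.independent R" "?V \<union> ?U \<subseteq> fun_vs.span R"
    using fun_vs.maximal_independent_subset_extend[of ?V "?V \<union> ?U"]
      indep_fam_independent[OF _ assms(1)] by auto
  have finR: "finite R" using R(2) by (rule finite_subset) simp
  have V_span: "?V \<subseteq> fun_vs.span ?U"
  proof -
    have "v j \<in> fun_vs.span ?U" if "j < m" for j
      by (rule supported_in_span) (use assms(2)[OF that] in auto)
    then show ?thesis by auto
  qed
  have U: "indep_fam {..<q} (unit_fun :: nat \<Rightarrow> nat \<Rightarrow> 'a)"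
    unfolding indep_fam_def
  proof (intro allI impI ballI)
    fix a :: "nat \<Rightarrow> 'a" and j assume a: "\<forall>z. (\<Sum>j<q. a j * unit_fun j z) = 0" "j \<in> {..<q}"
    have "(\<Sum>i<q. a i * unit_fun i j) = (\<Sum>i<q. if i = j then a i else 0)"
      by (rule sum.cong) (auto simp: unit_fun_def)
    then show "a j = 0" using a by simp
  qed
  have cardU: "card ?U = q" using card_image[OF indep_fam_inj_on[OF _ U]] by simp
  have "R \<subseteq> fun_vs.span ?U" using R(2) V_span fun_vs.span_superset by blast
  then have "card R \<le> q"
    using fun_vs.independent_span_bound[OF _ R(3), of ?U] cardU by simp
  moreover have "q \<le> card R"
    using fun_vs.independent_span_bound[OF finR indep_fam_independent[OF _ U]] R(4) cardU by simp
  ultimately have cardR: "card R = q" by simp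
  have "card (R - ?V) = q - m"
    using card_Diff_subset[of ?V R] R(1) cardR card_image[OF inj] by simp
  then obtain h where h: "bij_betw h {..<q - m} (R - ?V)"
    using ex_bij_betw_nat_finite[of "R - ?V"] finR by (auto simp: lessThan_atLeast0)
  define w where "w = (\<lambda>i. if i < q - m then h i else v (i - (q - m)))"
  define Q where "Q = mat q q (\<lambda>(i, t). w i t)"
  have w_img: "w ` {..<q} = R"
  proof -
    have "{..<q} = {..<q - m} \<union> (+) (q - m) ` {..<m}"
    proof (intro equalityI subsetI)
      fix i assume "i \<in> {..<q}"
      then show "i \<in> {..<q - m} \<union> (+) (q - m) ` {..<m}"
        using mq by (cases "i < q - m") (auto intro!: image_eqI[where x = "i - (q - m)"])
    qed (use mq in auto)
    moreover have "w ` {..<q - m} = R - ?V" using h by (auto simp: w_def bij_betw_def)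
    moreover have "w ` (+) (q - m) ` {..<m} = ?V" unfolding image_image by (simp add: w_def)
    ultimately show ?thesis using R(1) by (simp add: image_Un Un_absorb2)
  qed
  have w_inj: "inj_on w {..<q}" by (rule eq_card_imp_inj_on) (simp_all add: w_img cardR)
  have w_supp: "w i t = 0" if "i < q" "q \<le> t" for i t
  proof -
    have "w i \<in> ?V \<union> ?U" using that w_img R(2) by auto
    then show ?thesis using that assms(2) by (auto simp: unit_fun_def)
  qed
  have "det Q \<noteq> 0"
  proof
    assume "det Q = 0"
    \<comment> \<open>Transposing turns a kernel vector into a relation among the rows; reindexed by
      the set \<open>R\<close>, it contradicts the independence of \<open>R\<close>.\<close>
    then have "det (transpose_mat Q) = 0" using det_transpose[of Q q] by (simp add: Q_def)
    then obtain x where x: "x \<in> carrier_vec q" "x \<noteq> 0\<^sub>v q" "transpose_mat Q *\<^sub>v x = 0\<^sub>v q"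
      using det_0_iff_vec_prod_zero_field[of "transpose_mat Q" q] by (auto simp: Q_def)
    have "(\<Sum>i<q. x $ i * w i t) = 0" for t
    proof (cases "t < q")
      case True
      have "(\<Sum>i<q. x $ i * w i t) = (transpose_mat Q *\<^sub>v x) $ t"
        using True x(1) by (simp add: Q_def scalar_prod_def lessThan_atLeast0 mult.commute)
      then show ?thesis using x(3) True by simp
    qed (simp add: w_supp)
    then have "(\<Sum>i<q. (\<lambda>t. x $ i * w i t)) = 0" by (simp add: fun_eq_iff sum_fun_apply)
    moreover have "(\<Sum>i<q. (\<lambda>t. x $ i * w i t)) = (\<Sum>r\<in>R. (\<lambda>t. x $ (the_inv_into {..<q} w r) * r t))"
      unfolding w_img[symmetric] using w_inj by (simp add: sum.reindex the_inv_into_f_f)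
    ultimately have "(\<Sum>r\<in>R. (\<lambda>t. x $ (the_inv_into {..<q} w r) * r t)) = 0" by simp
    then have *: "\<forall>r\<in>R. x $ (the_inv_into {..<q} w r) = 0"
      using fun_vs.independentD[OF R(3) finR order_refl, of "\<lambda>r. x $ (the_inv_into {..<q} w r)"] by blast
    then have "x $ i = 0" if "i < q" for i
    proof -
      have "w i \<in> R" using that w_img by blast
      then have "x $ (the_inv_into {..<q} w (w i)) = 0" using * by blast
      then show ?thesis using that the_inv_into_f_f[OF w_inj, of i] by simp
    qed
    then show False using x(1,2) by (metis carrier_vecD eq_vecI index_zero_vec)
  qed
  then have "Q \<in> Units (ring_mat TYPE('a) q ())"
    using det_non_zero_imp_unit[of Q q] by (simp add: Q_def)
  then have "invertible_mat Q"
    unfolding Units_def ring_mat_def invertible_mat_def inverts_mat_def by (auto simp: Q_def)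
  moreover have "Q $$ (q - m + j, t) = v j t" if "j < m" "t < q" for j t
  proof -
    have "w (q - m + j) = v j" by (simp add: w_def)
    then show ?thesis using that mq by (simp add: Q_def)
  qed
  moreover have "Q \<in> carrier_mat q q" by (simp add: Q_def)
  ultimately show ?thesis using mq by blast
qed

subsection \<open>Range-preserving homomorphisms\<close>

text \<open>The entry is out of bounds; its junk value does not depend on the row, which excludes \<open>p = 0\<close>.\<close>
lemma index_mat_no_columns:
  assumes "M \<in> carrier_mat n 0" "i < n" "j < n"
  shows "M $$ (i, 0) = M $$ (j, 0)"
proof -
  have "M = mat n 0 (\<lambda>_. M $$ (0, 0))" by (rule eq_matI) (use assms in auto)
  then obtain c where "M = mat n 0 (\<lambda>_. c)" by blast
  then show ?thesis
    using assms(2,3) by (simp add: index_mat.rep_eq mat.rep_eq mk_mat_def undef_mat_def)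
qed

text \<open>\<open>L_blk\<close> and \<open>K_blk\<close> drop column 0 of \<open>M\<close>, so
  column \<open>l\<close> lands in position \<open>d + l - 1\<close>.\<close>

lemma block_mat_index:
  fixes M :: "'a::field mat"
  assumes "M \<in> carrier_mat n p" "0 < n" "0 < p" "A \<in> carrier_mat 1 d" "A' \<in> carrier_mat 1 (p - 1)"
  defines "FB \<equiv> four_block_mat A (L_blk p M + A') (0\<^sub>m (n - 1) d) (K_blk n p M)"
  shows "FB \<in> carrier_mat n (d + (p - 1))"
    "\<And>i t. i < n \<Longrightarrow> t < d \<Longrightarrow> FB $$ (i, t) = (if i = 0 then A $$ (0, t) else 0)"
    "\<And>i l. i < n \<Longrightarrow> l \<in> {1..<p} \<Longrightarrow>
       FB $$ (i, d + l - 1) = M $$ (i, l) + (if i = 0 then A' $$ (0, l - 1) else 0)"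
  using assms by (auto simp: L_blk_def K_blk_def)

lemma range_preserving_iff_left_ker:
  assumes "S \<subseteq> carrier_mat n p" "\<And>M. M \<in> S \<Longrightarrow> F M \<in> carrier_mat n q"
  shows "range_preserving S F \<longleftrightarrow> (\<forall>M\<in>S. \<forall>y. left_ker (F M) y \<longleftrightarrow> left_ker M y)"
proof -
  have "col_space (F M) = col_space M \<longleftrightarrow> (\<forall>y. left_ker (F M) y \<longleftrightarrow> left_ker M y)" if "M \<in> S" for M
  proof -
    have c: "M \<in> carrier_mat n p" "F M \<in> carrier_mat n q" using assms that by auto
    show ?thesis
      using col_space_subset_iff_left_ker[OF c] col_space_subset_iff_left_ker[OF c(2,1)] by blast
  qed
  then show ?thesis unfolding range_preserving_def by blast
qed

lemma left_ker_mult_invertible: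
  assumes "A \<in> carrier_mat n q" "Q \<in> carrier_mat q q" "invertible_mat (Q :: 'a::field mat)"
  shows "left_ker (A * Q) y \<longleftrightarrow> left_ker A y"
proof
  obtain P where P: "Q * P = 1\<^sub>m q" "P * Q = 1\<^sub>m (dim_row P)"
    using assms unfolding invertible_mat_def inverts_mat_def by auto
  \<comment> \<open>\<open>invertible_mat\<close> does not state the shape of the inverse; it is
    read off from the shapes of the two products.\<close>
  then have "dim_col (Q * P) = q" "dim_col (P * Q) = dim_row P" by auto
  then have Pc: "P \<in> carrier_mat q q" using assms by auto
  assume "left_ker (A * Q) y"
  then have "left_ker (A * Q * P) y" by (rule left_ker_mult[OF mult_carrier_mat[OF assms(1,2)] Pc])
  also have "A * Q * P = A" using assoc_mult_mat[OF assms(1,2) Pc] P assms(1) by simp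
  finally show "left_ker A y" .
qed (rule left_ker_mult[OF assms(1,2)])

section \<open>The two directions for spaces of the given block shape\<close>

context
  fixes S :: "'a::field mat set" and n p q :: nat
  assumes subsp: "subspace_mat n p S" and n2: "2 \<le> n" and p1: "1 \<le> p"
    and shape: "\<forall>M\<in>S. \<forall>i. 1 \<le> i \<and> i < n \<longrightarrow> M $$ (i, 0) = 0"
begin

lemma left_ker_iff_rows:
  assumes M: "M \<in> S"
  shows "left_ker M y \<longleftrightarrow> y 0 * M $$ (0, 0) = 0 \<and> (\<forall>l\<in>{1..<p}. (\<Sum>i<n. y i * M $$ (i, l)) = 0)"
proof -
  have c: "M \<in> carrier_mat n p" using subspace_matD[OF subsp] M by auto
  have "(\<Sum>i<n. y i * M $$ (i, 0)) = (\<Sum>i<n. if i = 0 then y 0 * M $$ (0, 0) else 0)"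
    by (rule sum.cong) (use shape M in auto)
  also have "\<dots> = y 0 * M $$ (0, 0)" using n2 by simp
  finally have 0: "(\<Sum>i<n. y i * M $$ (i, 0)) = y 0 * M $$ (0, 0)" .
  have "{..<p} = insert 0 {1..<p}" using p1 by auto
  moreover have "left_ker M y \<longleftrightarrow> (\<forall>l\<in>{..<p}. (\<Sum>i<n. y i * M $$ (i, l)) = 0)"
    using c by (auto simp: left_ker_def)
  ultimately show ?thesis by (simp add: 0)
qed

text \<open>Right multiplication by \<open>Q\<close> keeps the left kernel, so only the block matrix
  matters. If the corner entry is 0, both added rows vanish by additivity. Otherwise
  \<open>R\<close> is nonzero there, which forces \<open>y 0 = 0\<close> and makes the contribution
  of \<open>R'\<close> disappear.\<close>

lemma range_preserving_homomorphism_if_form: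
  assumes pq: "p \<le> q + 1" and Q: "Q \<in> carrier_mat q q" "invertible_mat Q"
    and R: "additive_row (q + 1 - p) R" "inj R" and R': "additive_row (p - 1) R'"
    and F: "\<And>M. M \<in> S \<Longrightarrow> F M = four_block_mat (R (M $$ (0, 0))) (L_blk p M + R' (M $$ (0, 0)))
                      (0\<^sub>m (n - 1) (q + 1 - p)) (K_blk n p M) * Q"
  shows "additive_on_mat S n q F \<and> range_preserving S F"
proof -
  define d where "d = q + 1 - p"
  have dq: "d + (p - 1) = q" using pq p1 by (simp add: d_def)
  note S' = subspace_matD[OF subsp]
  have Rc: "R a \<in> carrier_mat 1 d" "R' a \<in> carrier_mat 1 (p - 1)"
    and Radd: "R (a + b) = R a + R b" "R' (a + b) = R' a + R' b" for a b
    using R R' by (auto simp: additive_row_def d_def)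
  define FB where "FB = (\<lambda>M. four_block_mat (R (M $$ (0, 0))) (L_blk p M + R' (M $$ (0, 0)))
                      (0\<^sub>m (n - 1) d) (K_blk n p M))"
  have n0: "0 < n" and p0: "0 < p" using n2 p1 by auto
  have FBc: "FB M \<in> carrier_mat n q"
    and FB1: "\<And>i t. i < n \<Longrightarrow> t < d \<Longrightarrow> FB M $$ (i, t) = (if i = 0 then R (M $$ (0, 0)) $$ (0, t) else 0)"
    and FB2: "\<And>i l. i < n \<Longrightarrow> l \<in> {1..<p} \<Longrightarrow>
       FB M $$ (i, d + l - 1) = M $$ (i, l) + (if i = 0 then R' (M $$ (0, 0)) $$ (0, l - 1) else 0)"
    if "M \<in> S" for M
    using block_mat_index[OF S'(1)[OF that] n0 p0 Rc(1) Rc(2)] dq unfolding FB_def by auto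
  have F': "F M = FB M * Q" if "M \<in> S" for M using F[OF that] by (simp add: FB_def d_def)
  have Fc: "F M \<in> carrier_mat n q" if "M \<in> S" for M using F'[OF that] FBc[OF that] Q by simp
  have split: "t < d \<or> (\<exists>l\<in>{1..<p}. t = d + l - 1)" if "t < q" for t
  proof (cases "t < d")
    case False
    then have "t + 1 - d \<in> {1..<p}" "t = d + (t + 1 - d) - 1" using that dq by auto
    then show ?thesis by blast
  qed simp
  have FBadd: "FB (A + B) = FB A + FB B" if AB: "A \<in> S" "B \<in> S" for A B
  proof (rule eq_matI)
    have c: "A \<in> carrier_mat n p" "B \<in> carrier_mat n p" "A + B \<in> S" using S' AB by auto
    have A0: "(A + B) $$ (0, 0) = A $$ (0, 0) + B $$ (0, 0)" using c n0 p0 by simp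
    fix i t assume "i < dim_row (FB A + FB B)" "t < dim_col (FB A + FB B)"
    then have it: "i < n" "t < q" using FBc[OF AB(2)] by auto
    have s: "(FB A + FB B) $$ (i, t) = FB A $$ (i, t) + FB B $$ (i, t)" using FBc[OF AB(2)] it by simp
    from split[OF it(2)] show "FB (A + B) $$ (i, t) = (FB A + FB B) $$ (i, t)"
    proof
      assume t: "t < d"
      have "(R (A $$ (0, 0)) + R (B $$ (0, 0))) $$ (0, t) = R (A $$ (0, 0)) $$ (0, t) + R (B $$ (0, 0)) $$ (0, t)"
        using Rc t by (metis carrier_matD index_add_mat(1) less_one)
      then show ?thesis using t it unfolding s by (simp add: FB1 c AB A0 Radd)
    next
      assume "\<exists>l\<in>{1..<p}. t = d + l - 1"
      then obtain l where l: "l \<in> {1..<p}" "t = d + l - 1" by blast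
      have "(R' (A $$ (0, 0)) + R' (B $$ (0, 0))) $$ (0, l - 1)
          = R' (A $$ (0, 0)) $$ (0, l - 1) + R' (B $$ (0, 0)) $$ (0, l - 1)"
        using Rc(2)[of "B $$ (0, 0)"] l by (intro index_add_mat(1)) auto
      moreover have "(A + B) $$ (i, l) = A $$ (i, l) + B $$ (i, l)" using c it l by simp
      ultimately show ?thesis using it(1) unfolding s unfolding l(2)
        by (simp only: FB2[OF c(3) it(1) l(1)] FB2[OF AB(1) it(1) l(1)] FB2[OF AB(2) it(1) l(1)] A0 Radd)
          simp
    qed
  qed (use FBc[OF AB(2)] FBc[OF S'(3)[OF AB]] in auto)
  have "additive_on_mat S n q F"
    unfolding additive_on_mat_def
  proof (intro conjI ballI)
    fix A B assume AB: "A \<in> S" "B \<in> S"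
    then have "F (A + B) = (FB A + FB B) * Q" using S' by (simp add: F' FBadd)
    also have "\<dots> = F A + F B" using AB by (simp add: F' add_mult_distrib_mat[OF FBc FBc Q(1)])
    finally show "F (A + B) = F A + F B" .
  qed (rule Fc)
  moreover have "left_ker (F M) y \<longleftrightarrow> left_ker M y" if M: "M \<in> S" for M y
  proof -
    let ?m = "M $$ (0, 0)"
    have sum0: "(\<Sum>i<n. y i * (if i = 0 then c else 0)) = y 0 * c" for c
      using n0 by (simp add: if_distrib[of "\<lambda>x. _ * x"] cong: if_cong)
    have 1: "(\<Sum>i<n. y i * FB M $$ (i, t)) = y 0 * R ?m $$ (0, t)" if "t < d" for t
      using that FB1[OF M] sum0[of "R ?m $$ (0, t)"] by simp
    have 2: "(\<Sum>i<n. y i * FB M $$ (i, d + l - 1)) = (\<Sum>i<n. y i * M $$ (i, l)) + y 0 * R' ?m $$ (0, l - 1)"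
      if "l \<in> {1..<p}" for l
    proof -
      have "(\<Sum>i<n. y i * FB M $$ (i, d + l - 1))
        = (\<Sum>i<n. y i * M $$ (i, l) + y i * (if i = 0 then R' ?m $$ (0, l - 1) else 0))"
        by (rule sum.cong) (use FB2[OF M _ that] in \<open>auto simp: distrib_left\<close>)
      then show ?thesis by (simp only: sum.distrib sum0)
    qed
    have "left_ker (FB M) y \<longleftrightarrow> (\<forall>t<q. (\<Sum>i<n. y i * FB M $$ (i, t)) = 0)"
      using FBc[OF M] by (auto simp: left_ker_def)
    also have "\<dots> \<longleftrightarrow> (\<forall>t<d. y 0 * R ?m $$ (0, t) = 0) \<and>
        (\<forall>l\<in>{1..<p}. (\<Sum>i<n. y i * M $$ (i, l)) + y 0 * R' ?m $$ (0, l - 1) = 0)"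
    proof (intro iffI conjI allI impI ballI)
      fix t assume "\<forall>t<q. (\<Sum>i<n. y i * FB M $$ (i, t)) = 0" "t < d"
      then show "y 0 * R ?m $$ (0, t) = 0" using 1 dq by (metis add_lessD1 trans_less_add1)
    next
      fix l assume a: "\<forall>t<q. (\<Sum>i<n. y i * FB M $$ (i, t)) = 0" "l \<in> {1..<p}"
      then have "d + l - 1 < q" using dq by auto
      from a(1)[rule_format, OF this]
      show "(\<Sum>i<n. y i * M $$ (i, l)) + y 0 * R' ?m $$ (0, l - 1) = 0" unfolding 2[OF a(2)] .
    next
      fix t assume a: "(\<forall>t<d. y 0 * R ?m $$ (0, t) = 0) \<and>
        (\<forall>l\<in>{1..<p}. (\<Sum>i<n. y i * M $$ (i, l)) + y 0 * R' ?m $$ (0, l - 1) = 0)" "t < q"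
      from split[OF a(2)] show "(\<Sum>i<n. y i * FB M $$ (i, t)) = 0"
      proof
        assume "t < d"
        then show ?thesis using a(1) 1 by simp
      next
        assume "\<exists>l\<in>{1..<p}. t = d + l - 1"
        then obtain l where l: "l \<in> {1..<p}" "t = d + l - 1" by blast
        show ?thesis unfolding l(2) 2[OF l(1)] using a(1) l(1) by blast
      qed
    qed
    also have "\<dots> \<longleftrightarrow> left_ker M y"
    proof (cases "?m = 0")
      case True
      have "R 0 $$ (0, t) = 0" if "t < d" for t
      proof -
        have "R 0 $$ (0, t) = (R 0 + R 0) $$ (0, t)" using Radd(1)[of 0 0] by simp
        also have "\<dots> = R 0 $$ (0, t) + R 0 $$ (0, t)"
          using Rc(1)[of 0] that by (intro index_add_mat(1)) auto
        finally show ?thesis by (metis add_cancel_right_right)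
      qed
      moreover have "R' 0 $$ (0, l - 1) = 0" if "l \<in> {1..<p}" for l
      proof -
        have "R' 0 $$ (0, l - 1) = (R' 0 + R' 0) $$ (0, l - 1)" using Radd(2)[of 0 0] by simp
        also have "\<dots> = R' 0 $$ (0, l - 1) + R' 0 $$ (0, l - 1)"
          using Rc(2)[of 0] that by (intro index_add_mat(1)) auto
        finally show ?thesis by (metis add_cancel_right_right)
      qed
      ultimately show ?thesis using True by (simp add: left_ker_iff_rows[OF M])
    next
      case False
      have "\<exists>t<d. R ?m $$ (0, t) \<noteq> 0"
      proof (rule ccontr)
        assume "\<not> ?thesis"
        \<comment> \<open>That \<open>R ?m\<close> is zero is expressed as idempotence under
          addition; injectivity carries this back to \<open>?m\<close>.\<close>
        then have "R ?m + R ?m = R ?m" using Rc(1)[of ?m] by (intro eq_matI) auto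
        then have "?m + ?m = ?m" using R(2) Radd(1) by (metis injD)
        then show False using False by (metis add_cancel_right_right)
      qed
      then show ?thesis using False by (auto simp: left_ker_iff_rows[OF M])
    qed
    finally show ?thesis using left_ker_mult_invertible[OF FBc[OF M] Q] F'[OF M] by simp
  qed
  then have "range_preserving S F"
    using range_preserving_iff_left_ker[of S n p F q] S'(1) Fc by blast
  ultimately show ?thesis by blast
qed

lemma form_if_range_preserving_homomorphism:
  assumes cd: "codim_le S ({..<n} \<times> {..<p}) ((n - 2) + (n - 1))"
    and M\<^sub>1: "M\<^sub>1 \<in> S" "M\<^sub>1 $$ (0, 0) = 1"
    and Fhom: "additive_on_mat S n q F" and Frp: "range_preserving S F"
  shows "p \<le> q + 1 \<and> (\<exists>Q R R'. Q \<in> carrier_mat q q \<and> invertible_mat Q \<and>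
    additive_row (q + 1 - p) R \<and> inj R \<and> additive_row (p - 1) R' \<and>
    (\<forall>M\<in>S. F M = four_block_mat (R (M $$ (0, 0))) (L_blk p M + R' (M $$ (0, 0)))
                      (0\<^sub>m (n - 1) (q + 1 - p)) (K_blk n p M) * Q))"
proof -
  note S' = subspace_matD[OF subsp]
  have n0: "0 < n" and p0: "0 < p" using n2 p1 by auto
  let ?C = "{1..<p}"
  define S\<^sub>0 where "S\<^sub>0 = {M \<in> S. M $$ (0, 0) = 0}"
  have idx: "(A + B) $$ (i, l) = A $$ (i, l) + B $$ (i, l)" "(c \<cdot>\<^sub>m A) $$ (i, l) = c * A $$ (i, l)"
    if "A \<in> S" "B \<in> S" "i < n" "l < p" for A B c i l
    using S'(1)[OF that(1)] S'(1)[OF that(2)] that by auto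
  have S0: "subspace_mat n p S\<^sub>0"
    unfolding subspace_mat_def S\<^sub>0_def using S' n0 p0 by (auto simp: idx)
  have cd0: "codim_le S\<^sub>0 ({..<n} \<times> ?C) (n - 2)"
    unfolding S\<^sub>0_def by (rule codim_le_first_column_zero[OF subsp shape cd n0 p0 M\<^sub>1])
  have Fc: "F M \<in> carrier_mat n q" if "M \<in> S" for M
    using Fhom that by (simp add: additive_on_mat_def)
  have Fadd: "F (A + B) = F A + F B" if "A \<in> S" "B \<in> S" for A B
    using Fhom that by (simp add: additive_on_mat_def)
  have Fidx: "F (A + B) $$ (i, j) = F A $$ (i, j) + F B $$ (i, j)"
    if "A \<in> S" "B \<in> S" "i < n" "j < q" for A B i j
    using Fadd[OF that(1,2)] Fc[OF that(2)] that by simp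
  have ker: "(\<forall>j<q. (\<Sum>i<n. y i * F M $$ (i, j)) = 0) \<longleftrightarrow>
      y 0 * M $$ (0, 0) = 0 \<and> (\<forall>l\<in>?C. (\<Sum>i<n. y i * M $$ (i, l)) = 0)" if M: "M \<in> S" for M y
  proof -
    have "(\<forall>j<q. (\<Sum>i<n. y i * F M $$ (i, j)) = 0) \<longleftrightarrow> left_ker (F M) y"
      using Fc[OF M] by (auto simp: left_ker_def)
    also have "\<dots> \<longleftrightarrow> left_ker M y"
      using Frp range_preserving_iff_left_ker[of S n p F q] S'(1) Fc M by blast
    finally show ?thesis using left_ker_iff_rows[OF M] by simp
  qed

  \<comment> \<open>On \<open>S\<^sub>0\<close> the left kernel condition involves the columns from
    1 on only, so each column of \<open>F\<close> is range-compatible on all \<open>n\<close>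
    rows.\<close>
  have "\<exists>x. \<forall>N\<in>S\<^sub>0. \<forall>i\<in>{..<n}. F N $$ (i, j) = (\<Sum>l\<in>?C. N $$ (i, l) * x l)" if j: "j < q" for j
  proof (rule range_compatible_local[OF S0])
    show "?C \<subseteq> {..<p}" by auto
    show "2 \<le> card {..<n}" using n2 by simp
    show "codim_le S\<^sub>0 ({..<n} \<times> ?C) (card {..<n} - 2)" using cd0 by simp
    show "F (A + B) $$ (i, j) = F A $$ (i, j) + F B $$ (i, j)"
      if "A \<in> S\<^sub>0" "B \<in> S\<^sub>0" "i \<in> {..<n}" for A B i
      using Fidx that j by (auto simp: S\<^sub>0_def)
    show "(\<Sum>i<n. y i * F N $$ (i, j)) = 0"
      if "N \<in> S\<^sub>0" "\<And>l. l \<in> ?C \<Longrightarrow> (\<Sum>i<n. y i * N $$ (i, l)) = 0" for N y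
      using ker[of N y] that j by (auto simp: S\<^sub>0_def)
  qed simp
  then obtain X where X: "\<And>j N i. j < q \<Longrightarrow> N \<in> S\<^sub>0 \<Longrightarrow> i < n \<Longrightarrow>
      F N $$ (i, j) = (\<Sum>l\<in>?C. N $$ (i, l) * X j l)"
    by (metis lessThan_iff)

  \<comment> \<open>The part of \<open>F\<close> that the linear maps \<open>X\<close> do not
    explain. It vanishes on \<open>S\<^sub>0\<close>, so it depends only on the corner entry and can
    be computed on multiples of \<open>M\<^sub>1\<close>.\<close>
  define \<Psi> where "\<Psi> = (\<lambda>a i j. F (a \<cdot>\<^sub>m M\<^sub>1) $$ (i, j) - (\<Sum>l\<in>?C. (a \<cdot>\<^sub>m M\<^sub>1) $$ (i, l) * X j l))"
  have aM1: "a \<cdot>\<^sub>m M\<^sub>1 \<in> S" for a using S' M\<^sub>1 by blast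
  have coset: "N + a \<cdot>\<^sub>m M\<^sub>1 \<in> S" "(N + a \<cdot>\<^sub>m M\<^sub>1) $$ (0, 0) = a" if "N \<in> S\<^sub>0" for N a
    using that S'(3)[OF _ aM1] aM1 M\<^sub>1 n0 p0 by (auto simp: S\<^sub>0_def idx)
  have F_\<Psi>: "F M $$ (i, j) = (\<Sum>l\<in>?C. M $$ (i, l) * X j l) + \<Psi> (M $$ (0, 0)) i j"
    if M: "M \<in> S" and ij: "i < n" "j < q" for M i j
  proof -
    let ?a = "M $$ (0, 0)"
    let ?N = "M + (- ?a) \<cdot>\<^sub>m M\<^sub>1"
    have N: "?N \<in> S\<^sub>0" using S'(3)[OF M aM1] M\<^sub>1 M aM1 n0 p0 by (auto simp: S\<^sub>0_def idx)
    then have NS: "?N \<in> S" by (simp add: S\<^sub>0_def)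
    have "M = ?N + ?a \<cdot>\<^sub>m M\<^sub>1"
      by (rule eq_matI) (use S'(1)[OF M] S'(1)[OF M\<^sub>1(1)] in auto)
    then have "F M $$ (i, j) = F ?N $$ (i, j) + F (?a \<cdot>\<^sub>m M\<^sub>1) $$ (i, j)"
      using Fidx[OF NS aM1 ij] by metis
    also have "F ?N $$ (i, j) = (\<Sum>l\<in>?C. M $$ (i, l) * X j l - (?a \<cdot>\<^sub>m M\<^sub>1) $$ (i, l) * X j l)"
      unfolding X[OF ij(2) N ij(1)]
      by (rule sum.cong) (use ij aM1 M M\<^sub>1 in \<open>auto simp: idx algebra_simps\<close>)
    finally show ?thesis by (simp add: \<Psi>_def sum_subtractf)
  qed
  have \<Psi>_add: "\<Psi> (a + b) i j = \<Psi> a i j + \<Psi> b i j" if ij: "i < n" "j < q" for a b i j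
  proof -
    have "(a + b) \<cdot>\<^sub>m M\<^sub>1 = a \<cdot>\<^sub>m M\<^sub>1 + b \<cdot>\<^sub>m M\<^sub>1"
      by (rule eq_matI) (auto simp: algebra_simps)
    moreover have "(\<Sum>l\<in>?C. (a \<cdot>\<^sub>m M\<^sub>1 + b \<cdot>\<^sub>m M\<^sub>1) $$ (i, l) * X j l)
        = (\<Sum>l\<in>?C. (a \<cdot>\<^sub>m M\<^sub>1) $$ (i, l) * X j l + (b \<cdot>\<^sub>m M\<^sub>1) $$ (i, l) * X j l)"
      by (rule sum.cong) (use idx(1)[OF aM1 aM1 ij(1)] in \<open>auto simp: distrib_right\<close>)
    ultimately show ?thesis
      unfolding \<Psi>_def by (simp add: Fidx[OF aM1 aM1 ij] sum.distrib)
  qed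
  have yF: "(\<Sum>i<n. y i * F M $$ (i, j)) = (\<Sum>l\<in>?C. (\<Sum>i<n. y i * M $$ (i, l)) * X j l)
      + (\<Sum>i<n. y i * \<Psi> (M $$ (0, 0)) i j)" if "M \<in> S" "j < q" for M y j
  proof -
    have "(\<Sum>i<n. y i * F M $$ (i, j)) = (\<Sum>i<n. (\<Sum>l\<in>?C. y i * M $$ (i, l) * X j l) + y i * \<Psi> (M $$ (0, 0)) i j)"
      by (rule sum.cong) (use that in \<open>simp_all add: F_\<Psi> distrib_left sum_distrib_left mult.assoc\<close>)
    also have "\<dots> = (\<Sum>i<n. \<Sum>l\<in>?C. y i * M $$ (i, l) * X j l) + (\<Sum>i<n. y i * \<Psi> (M $$ (0, 0)) i j)"
      by (rule sum.distrib)
    also have "(\<Sum>i<n. \<Sum>l\<in>?C. y i * M $$ (i, l) * X j l) = (\<Sum>l\<in>?C. (\<Sum>i<n. y i * M $$ (i, l)) * X j l)"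
      by (subst sum.swap) (simp add: sum_distrib_right)
    finally show ?thesis .
  qed

  have two: "(\<Sum>h<n. ((if h = i then 1 else 0) + (if h = k then c else 0)) * g h) = g i + c * g k"
    if "i < n" "k < n" for i k c and g :: "nat \<Rightarrow> 'a"
    using that by (simp add: distrib_right sum.distrib if_distrib[of "\<lambda>x. x * _"] cong: if_cong)
  \<comment> \<open>Row 0 is excluded as a candidate, yet the \<open>n - 1\<close> other rows still
    outnumber the \<open>n - 2\<close> forms. The zero matrix serves as the reference for row
    \<open>k\<close>.\<close>
  have rows: "\<exists>i\<in>{1..<n}. \<exists>N\<in>S\<^sub>0. (\<forall>l\<in>?C. N $$ (i, l) = r i l) \<and> (i \<noteq> k \<longrightarrow> (\<forall>l\<in>?C. N $$ (k, l) = 0))"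
    if k: "k < n" for k and r :: "nat \<Rightarrow> nat \<Rightarrow> 'a"
  proof -
    have "\<exists>i\<in>{1..<n}. \<exists>N\<in>S\<^sub>0. (\<forall>l\<in>?C. N $$ (i, l) = r i l) \<and>
        (i \<noteq> k \<longrightarrow> (\<forall>l\<in>?C. N $$ (k, l) = 0\<^sub>m n p $$ (k, l)))"
      by (rule prescribe_two_rows[OF S0 _ _ _ _ _ cd0]) (use k n2 S0 in \<open>auto simp: subspace_mat_def\<close>)
    then show ?thesis using k by (auto 0 4)
  qed

  have \<Psi>0: "\<Psi> a k j = 0" if k: "1 \<le> k" "k < n" and j: "j < q" for a k j
  proof (rule ccontr)
    assume ne: "\<Psi> a k j \<noteq> 0"
    \<comment> \<open>The row \<open>i\<close> is not known in advance, so the coefficient is chosen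
      for every \<open>i\<close>, in such a way that
      \<open>\<Psi> a i j + c i * \<Psi> a k j\<close> is nonzero. Adding \<open>N\<close> makes the
      same combination of rows of the matrix vanish, and \<open>y\<close> is 0 at the first row, so
      range preservation forces that sum to be 0.\<close>
    define c :: "nat \<Rightarrow> 'a" where "c = (\<lambda>i. if i = k \<or> \<Psi> a i j \<noteq> 0 then 0 else 1)"
    let ?A = "a \<cdot>\<^sub>m M\<^sub>1"
    obtain i N where i: "1 \<le> i" "i < n" and N: "N \<in> S\<^sub>0"
      "\<And>l. l \<in> ?C \<Longrightarrow> N $$ (i, l) = - ?A $$ (i, l) - c i * ?A $$ (k, l)"
      "\<And>l. i \<noteq> k \<Longrightarrow> l \<in> ?C \<Longrightarrow> N $$ (k, l) = 0"
      using rows[OF k(2), of "\<lambda>i l. - ?A $$ (i, l) - c i * ?A $$ (k, l)"]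
      by (metis atLeastLessThan_iff)
    define y :: "nat \<Rightarrow> 'a" where "y = (\<lambda>h. (if h = i then 1 else 0) + (if h = k then c i else 0))"
    let ?M = "N + ?A"
    have NS: "N \<in> S" using N by (simp add: S\<^sub>0_def)
    have "y 0 * ?M $$ (0, 0) = 0" using i k by (simp add: y_def)
    moreover have "(\<Sum>h<n. y h * ?M $$ (h, l)) = 0" if l: "l \<in> ?C" for l
    proof -
      have "(\<Sum>h<n. y h * ?M $$ (h, l)) = ?M $$ (i, l) + c i * ?M $$ (k, l)"
        unfolding y_def by (rule two[OF i(2) k(2)])
      also have "\<dots> = N $$ (i, l) + ?A $$ (i, l) + c i * (N $$ (k, l) + ?A $$ (k, l))"
        using i k l by (simp add: idx(1)[OF NS aM1])
      also have "c i * (N $$ (k, l) + ?A $$ (k, l)) = c i * ?A $$ (k, l)"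
        using N(3)[OF _ l] by (cases "i = k") (simp_all add: c_def)
      finally show ?thesis using N(2)[OF l] by simp
    qed
    ultimately have "(\<Sum>h<n. y h * F ?M $$ (h, j)) = 0" "(\<Sum>l\<in>?C. (\<Sum>h<n. y h * ?M $$ (h, l)) * X j l) = 0"
      using ker[OF coset(1)[OF N(1)], of y a] j by auto
    then have "(\<Sum>h<n. y h * \<Psi> a h j) = 0"
      using yF[OF coset(1)[OF N(1)] j, of y a] coset(2)[OF N(1), of a] by simp
    then have "\<Psi> a i j + c i * \<Psi> a k j = 0"
      unfolding y_def using two[OF i(2) k(2), of "c i" "\<lambda>h. \<Psi> a h j"] by simp
    then show False using ne by (auto simp: c_def split: if_splits)
  qed
  define \<phi> where "\<phi> = (\<lambda>a. \<Psi> a 0)"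
  have \<Psi>_sum: "(\<Sum>i<n. y i * \<Psi> a i j) = y 0 * \<phi> a j" if "j < q" for y a j
  proof -
    have "(\<Sum>i<n. y i * \<Psi> a i j) = (\<Sum>i<n. if i = 0 then y 0 * \<phi> a j else 0)"
      by (rule sum.cong) (use \<Psi>0 that in \<open>auto simp: \<phi>_def\<close>)
    then show ?thesis using n0 by simp
  qed

  define v where "v = (\<lambda>l j. if j < q then X j (Suc l) else 0)"
  have sum_C: "(\<Sum>l\<in>?C. g l) = (\<Sum>l<p - 1. g (Suc l))" for g :: "nat \<Rightarrow> 'a"
    by (rule sum.reindex_bij_witness[of _ Suc "\<lambda>l. l - 1"]) auto
  \<comment> \<open>A relation \<open>z\<close> among the rows is written into some row of a matrix
    of \<open>S\<^sub>0\<close>. That row of its image vanishes, so by the other inclusion of left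
    kernels the row itself, which is \<open>z\<close>, vanishes.\<close>
  have "indep_fam {..<p - 1} v"
    unfolding indep_fam_def
  proof (intro allI impI ballI)
    fix z l assume z: "\<forall>t. (\<Sum>l<p - 1. z l * v l t) = 0" and l: "l \<in> {..<p - 1}"
    obtain i N where i: "1 \<le> i" "i < n" and N: "N \<in> S\<^sub>0" "\<And>l. l \<in> ?C \<Longrightarrow> N $$ (i, l) = z (l - 1)"
      using rows[OF n0, of "\<lambda>i l. z (l - 1)"] by auto
    have NS: "N \<in> S" using N by (simp add: S\<^sub>0_def)
    let ?y = "\<lambda>h. (if h = i then 1 else 0) + (if h = i then 0 else 0) :: 'a"
    have y: "(\<Sum>h<n. ?y h * g h) = g i" for g using two[OF i(2) i(2), of 0 g] by simp
    have "(\<Sum>h<n. ?y h * F N $$ (h, j)) = 0" if j: "j < q" for j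
    proof -
      have "(\<Sum>h<n. ?y h * F N $$ (h, j)) = F N $$ (i, j)" by (rule y)
      also have "\<dots> = (\<Sum>l\<in>?C. z (l - 1) * X j l)"
        unfolding X[OF j N(1) i(2)] by (rule sum.cong) (use N in auto)
      also have "\<dots> = (\<Sum>l<p - 1. z l * v l j)" unfolding sum_C using j by (simp add: v_def)
      finally show ?thesis using z by simp
    qed
    then have "(\<Sum>h<n. ?y h * N $$ (h, Suc l)) = 0" using ker[OF NS, of ?y] l by auto
    then show "z l = 0" using N(2)[of "Suc l"] l y[of "\<lambda>h. N $$ (h, Suc l)"] by simp
  qed
  then have "p - 1 \<le> q \<and> (\<exists>Q. Q \<in> carrier_mat q q \<and> invertible_mat Q \<and>
      (\<forall>l<p - 1. \<forall>t<q. Q $$ (q - (p - 1) + l, t) = v l t))"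
    by (rule complete_rows_to_invertible) (simp add: v_def)
  then obtain Q where pq: "p - 1 \<le> q" and Q: "Q \<in> carrier_mat q q" "invertible_mat Q"
    and Qv: "\<And>l t. l < p - 1 \<Longrightarrow> t < q \<Longrightarrow> Q $$ (q - (p - 1) + l, t) = v l t" by blast
  define d where "d = q + 1 - p"
  have dq: "d + (p - 1) = q" "q - (p - 1) = d" using pq p1 by (auto simp: d_def)
  have QX: "Q $$ (d + l - 1, j) = X j l" if "l \<in> ?C" "j < q" for l j
    using Qv[of "l - 1" j] that dq(2) by (auto simp: v_def)
  have split_sum: "(\<Sum>t<d + m. g t) = (\<Sum>t<d. g t) + (\<Sum>l<m. g (d + l))" for m and g :: "nat \<Rightarrow> 'a"
    by (induction m) (simp_all add: add.assoc)
  have sum_Q: "(\<Sum>t<q. g t * Q $$ (t, j)) = (\<Sum>t<d. g t * Q $$ (t, j)) + (\<Sum>l\<in>?C. g (d + l - 1) * X j l)"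
    if j: "j < q" for g j
  proof -
    have "(\<Sum>t<q. g t * Q $$ (t, j)) = (\<Sum>t<d. g t * Q $$ (t, j)) + (\<Sum>l<p - 1. g (d + l) * Q $$ (d + l, j))"
      unfolding dq(1)[symmetric] by (rule split_sum)
    also have "(\<Sum>l<p - 1. g (d + l) * Q $$ (d + l, j)) = (\<Sum>l\<in>?C. g (d + l - 1) * Q $$ (d + l - 1, j))"
      unfolding sum_C by simp
    also have "\<dots> = (\<Sum>l\<in>?C. g (d + l - 1) * X j l)" by (rule sum.cong) (use QX j in auto)
    finally show ?thesis .
  qed

  obtain P where P: "Q * P = 1\<^sub>m q" "P * Q = 1\<^sub>m (dim_row P)"
    using Q unfolding invertible_mat_def inverts_mat_def by auto
  then have "dim_col (Q * P) = q" "dim_col (P * Q) = dim_row P" by auto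
  then have Pc: "P \<in> carrier_mat q q" using Q by auto
  \<comment> \<open>The coordinates of \<open>\<phi> a\<close> with respect to the rows of
    \<open>Q\<close>: the first \<open>d\<close> of them form \<open>R\<close>, the remaining ones
    \<open>R'\<close>.\<close>
  define \<rho> where "\<rho> = (\<lambda>a t. \<Sum>s<q. \<phi> a s * P $$ (s, t))"
  have \<rho>Q: "(\<Sum>t<q. \<rho> a t * Q $$ (t, j)) = \<phi> a j" if j: "j < q" for a j
  proof -
    have "(\<Sum>t<q. \<rho> a t * Q $$ (t, j)) = (\<Sum>s<q. \<phi> a s * (\<Sum>t<q. P $$ (s, t) * Q $$ (t, j)))"
      unfolding \<rho>_def sum_distrib_right sum_distrib_left by (subst sum.swap) (simp add: mult.assoc)
    also have "\<dots> = (\<Sum>s<q. \<phi> a s * (P * Q) $$ (s, j))"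
      by (rule sum.cong) (use Pc Q j in \<open>auto simp: scalar_prod_def lessThan_atLeast0\<close>)
    also have "\<dots> = (\<Sum>s<q. if s = j then \<phi> a j else 0)"
      by (rule sum.cong) (use P Pc j in auto)
    finally show ?thesis using j by simp
  qed
  have \<rho>_add: "\<rho> (a + b) t = \<rho> a t + \<rho> b t" for a b t
    unfolding \<rho>_def using \<Psi>_add n0 by (simp add: \<phi>_def distrib_right sum.distrib)
  define R where "R = (\<lambda>a. mat 1 d (\<lambda>(_, t). \<rho> a t))"
  define R' where "R' = (\<lambda>a. mat 1 (p - 1) (\<lambda>(_, l). \<rho> a (d + l)))"
  have R_add: "additive_row d R" "additive_row (p - 1) R'"
    unfolding additive_row_def R_def R'_def by (auto intro!: eq_matI simp: \<rho>_add)

  have "inj R"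
  proof (rule injI, rule ccontr)
    fix a b assume ab: "R a = R b" "a \<noteq> b"
    define c where "c = a - b"
    have c0: "\<rho> c t = 0" if "t < d" for t
    proof -
      have "\<rho> a t = \<rho> b t" using arg_cong[OF ab(1), of "\<lambda>A. A $$ (0, t)"] that by (simp add: R_def)
      then show ?thesis using \<rho>_add[of c b t] by (simp add: c_def)
    qed
    let ?A = "c \<cdot>\<^sub>m M\<^sub>1"
    \<comment> \<open>When the first \<open>d\<close> coordinates of \<open>\<phi> c\<close> vanish,
      the rest is a combination of the vectors from \<open>X\<close> and can be cancelled by the
      linear part. Row \<open>i\<close> is chosen so that the sum of rows 0 and \<open>i\<close> of
      \<open>N + c \<cdot>\<^sub>m M\<^sub>1\<close> does this. Then \<open>y\<close> is in the left
      kernel of the image although \<open>y 0 = 1\<close>, which forces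
      \<open>c = 0\<close>.\<close>
    obtain i N where i: "1 \<le> i" "i < n" and N: "N \<in> S\<^sub>0"
      "\<And>l. l \<in> ?C \<Longrightarrow> N $$ (i, l) = - (?A $$ (0, l) + ?A $$ (i, l) + \<rho> c (d + l - 1))"
      "\<And>l. l \<in> ?C \<Longrightarrow> N $$ (0, l) = 0"
      using rows[OF n0, of "\<lambda>i l. - (?A $$ (0, l) + ?A $$ (i, l) + \<rho> c (d + l - 1))"] by fastforce
    define y :: "nat \<Rightarrow> 'a" where "y = (\<lambda>h. (if h = i then 1 else 0) + (if h = 0 then 1 else 0))"
    let ?M = "N + ?A"
    have NS: "N \<in> S" using N by (simp add: S\<^sub>0_def)
    have yM: "(\<Sum>h<n. y h * ?M $$ (h, l)) = - \<rho> c (d + l - 1)" if l: "l \<in> ?C" for l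
    proof -
      have "(\<Sum>h<n. y h * ?M $$ (h, l)) = ?M $$ (i, l) + 1 * ?M $$ (0, l)"
        unfolding y_def by (rule two[OF i(2) n0])
      then show ?thesis using N(2,3)[OF l] i l n0 by (simp add: idx(1)[OF NS aM1])
    qed
    have y0: "y 0 = 1" using i by (simp add: y_def)
    have "(\<Sum>h<n. y h * F ?M $$ (h, j)) = 0" if j: "j < q" for j
    proof -
      have "(\<Sum>h<n. y h * F ?M $$ (h, j)) = (\<Sum>l\<in>?C. - \<rho> c (d + l - 1) * X j l) + \<phi> c j"
        unfolding yF[OF coset(1)[OF N(1)] j] coset(2)[OF N(1)] \<Psi>_sum[OF j] y0
        using yM by simp
      also have "\<phi> c j = (\<Sum>l\<in>?C. \<rho> c (d + l - 1) * X j l)"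
        unfolding \<rho>Q[OF j, symmetric] sum_Q[OF j] using c0 by simp
      finally show ?thesis by (simp add: sum_negf)
    qed
    then have "y 0 * ?M $$ (0, 0) = 0" using ker[OF coset(1)[OF N(1)], of y c] by blast
    then show False using ab(2) coset(2)[OF N(1), of c] y0 by (simp add: c_def)
  qed
  moreover have "F M = four_block_mat (R (M $$ (0, 0))) (L_blk p M + R' (M $$ (0, 0)))
                      (0\<^sub>m (n - 1) d) (K_blk n p M) * Q" if M: "M \<in> S" for M
  proof (rule eq_matI)
    let ?m = "M $$ (0, 0)"
    let ?FB = "four_block_mat (R ?m) (L_blk p M + R' ?m) (0\<^sub>m (n - 1) d) (K_blk n p M)"
    have Rc: "R ?m \<in> carrier_mat 1 d" "R' ?m \<in> carrier_mat 1 (p - 1)" by (auto simp: R_def R'_def)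
    note FB = block_mat_index[OF S'(1)[OF M] n0 p0 Rc]
    have FBc: "?FB \<in> carrier_mat n q" using FB(1) dq(1) by simp
    show "dim_row (F M) = dim_row (?FB * Q)" "dim_col (F M) = dim_col (?FB * Q)"
      using Fc[OF M] FBc Q by auto
    fix i j assume "i < dim_row (?FB * Q)" "j < dim_col (?FB * Q)"
    then have ij: "i < n" "j < q" using FBc Q by auto
    let ?\<rho> = "\<lambda>t. if i = 0 then \<rho> ?m t else 0"
    have "(?FB * Q) $$ (i, j) = (\<Sum>t<q. ?FB $$ (i, t) * Q $$ (t, j))"
      using FBc Q ij by (auto simp: scalar_prod_def lessThan_atLeast0 simp del: index_mat_four_block)
    also have "\<dots> = (\<Sum>t<d. ?FB $$ (i, t) * Q $$ (t, j)) + (\<Sum>l\<in>?C. ?FB $$ (i, d + l - 1) * X j l)"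
      by (rule sum_Q[OF ij(2)])
    also have "(\<Sum>t<d. ?FB $$ (i, t) * Q $$ (t, j)) = (\<Sum>t<d. ?\<rho> t * Q $$ (t, j))"
      by (rule sum.cong) (use FB(2)[OF ij(1)] in \<open>auto simp: R_def\<close>)
    also have "(\<Sum>l\<in>?C. ?FB $$ (i, d + l - 1) * X j l)
        = (\<Sum>l\<in>?C. M $$ (i, l) * X j l + ?\<rho> (d + l - 1) * X j l)"
      by (rule sum.cong) (use FB(3)[OF ij(1)] in \<open>auto simp: R'_def distrib_right\<close>)
    also have "(\<Sum>t<d. ?\<rho> t * Q $$ (t, j)) + \<dots>
        = (\<Sum>l\<in>?C. M $$ (i, l) * X j l) + (\<Sum>t<q. ?\<rho> t * Q $$ (t, j))"
      unfolding sum_Q[OF ij(2)] by (simp add: sum.distrib)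
    also have "(\<Sum>t<q. ?\<rho> t * Q $$ (t, j)) = \<Psi> ?m i j"
      using \<rho>Q[OF ij(2)] \<Psi>0 ij by (cases "i = 0") (auto simp: \<phi>_def)
    finally show "F M $$ (i, j) = (?FB * Q) $$ (i, j)" using F_\<Psi>[OF M ij] by simp
  qed
  ultimately show ?thesis
    using Q R_add pq p1 unfolding d_def by (intro conjI exI[of _ Q] exI[of _ R] exI[of _ R']) auto
qed

end

text \<open>The guard \<open>p \<le> q + 1\<close> makes the truncated width
  \<open>q + 1 - p\<close> the true one. In the boundary case \<open>p = q + 1\<close> both sides of
  the equivalence are false, since \<open>R\<close> would take values in rows of width 0.\<close>

theorem theorem7p6:
  fixes S :: "'a::field mat set" and n p q :: nat
  assumes subsp: "subspace_mat n p S"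
    and codim: "int (codim_mat_space n p S) \<le> 2 * int n - 3"
    and shape: "\<forall>M\<in>S. \<forall>i. 1 \<le> i \<and> i < n \<longrightarrow> M $$ (i, 0) = 0"
    and nonzero_col: "\<exists>M\<in>S. \<exists>i<n. M $$ (i, 0) \<noteq> 0"
    and q: "q \<ge> 1"
  shows "(p \<le> q + 1 \<longrightarrow>
           (\<forall>F. (additive_on_mat S n q F \<and> range_preserving S F) \<longleftrightarrow>
              (\<exists>Q R R'. Q \<in> carrier_mat q q \<and> invertible_mat Q \<and>
                 additive_row (q + 1 - p) R \<and> inj R \<and> additive_row (p - 1) R' \<and>
                 (\<forall>M\<in>S. F M =
                    four_block_mat (R (M $$ (0, 0))) (L_blk p M + R' (M $$ (0, 0)))
                      (0\<^sub>m (n - 1) (q + 1 - p)) (K_blk n p M) * Q))))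
       \<and> ((\<exists>F. additive_on_mat S n q F \<and> range_preserving S F) \<longleftrightarrow> p \<le> q)"
proof -
  note S' = subspace_matD[OF subsp]
  \<comment> \<open>A codimension is nonnegative and the bound is stated over the integers, so
    \<open>2 * int n - 3\<close> cannot be negative.\<close>
  have n2: "2 \<le> n" using codim by linarith
  obtain M i where Mi: "M \<in> S" "i < n" "M $$ (i, 0) \<noteq> 0" using nonzero_col by blast
  have M0: "M $$ (0, 0) \<noteq> 0" using shape Mi by (cases i) auto
  have p1: "1 \<le> p"
  proof (rule ccontr)
    assume "\<not> 1 \<le> p"
    then have "p = 0" by simp
    then have "M \<in> carrier_mat n 0" using S'(1)[OF Mi(1)] by simp
    then have "M $$ (0, 0) = M $$ (1, 0)" by (rule index_mat_no_columns) (use n2 in auto)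
    then show False using shape Mi(1) M0 n2 by auto
  qed
  define M\<^sub>1 where "M\<^sub>1 = (1 / M $$ (0, 0)) \<cdot>\<^sub>m M"
  have M1: "M\<^sub>1 \<in> S" "M\<^sub>1 $$ (0, 0) = 1"
    using S'(1)[OF Mi(1)] S'(4)[OF Mi(1)] M0 n2 p1 by (auto simp: M\<^sub>1_def)
  have "codim_mat_space n p S \<le> (n - 2) + (n - 1)" using codim n2 by linarith
  then have cd: "codim_le S ({..<n} \<times> {..<p}) ((n - 2) + (n - 1))"
    using codim_le_codim_mat_space[of S n p] unfolding codim_le_def by (meson order_trans)
  note fwd = form_if_range_preserving_homomorphism[OF subsp n2 p1 shape cd M1]
  note bwd = range_preserving_homomorphism_if_form[OF subsp n2 p1 shape]
  have "p \<le> q" if F: "additive_on_mat S n q F" "range_preserving S F" for F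
  proof (rule ccontr)
    assume "\<not> p \<le> q"
    moreover obtain R :: "'a \<Rightarrow> 'a mat" where R: "additive_row (q + 1 - p) R" "inj R"
      using fwd[OF F] by blast
    ultimately have "R a \<in> carrier_mat 1 0" for a by (simp add: additive_row_def)
    then have "R 0 = R 1" by (intro eq_matI) (metis carrier_matD not_less_zero)+
    then show False using R(2) by (metis injD zero_neq_one)
  qed
  moreover have "\<exists>F. additive_on_mat S n q F \<and> range_preserving S F" if "p \<le> q"
  proof -
    \<comment> \<open>With \<open>p \<le> q\<close> the block has width at least 1, which leaves
      room for the corner entry itself; \<open>R' = 0\<close> and \<open>Q = 1\<close> complete the
      example.\<close>
    define R :: "'a \<Rightarrow> 'a mat" where "R = (\<lambda>a. mat 1 (q + 1 - p) (\<lambda>(i, j). if j = 0 then a else 0))"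
    have "additive_row (q + 1 - p) R" by (auto simp: additive_row_def R_def intro!: eq_matI)
    moreover have "inj R"
    proof (rule injI)
      fix a b assume "R a = R b"
      from arg_cong[OF this, of "\<lambda>A. A $$ (0, 0)"] show "a = b" using that by (simp add: R_def)
    qed
    moreover have "additive_row (p - 1) (\<lambda>_. 0\<^sub>m 1 (p - 1) :: 'a mat)" by (simp add: additive_row_def)
    moreover have "invertible_mat (1\<^sub>m q :: 'a mat)"
      unfolding invertible_mat_def inverts_mat_def by (auto intro!: exI[of _ "1\<^sub>m q"])
    ultimately show ?thesis using that by (intro exI bwd[OF _ one_carrier_mat]) auto
  qed
  moreover have "(additive_on_mat S n q F \<and> range_preserving S F) \<longleftrightarrow>
              (\<exists>Q R R'. Q \<in> carrier_mat q q \<and> invertible_mat Q \<and>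
                 additive_row (q + 1 - p) R \<and> inj R \<and> additive_row (p - 1) R' \<and>
                 (\<forall>M\<in>S. F M =
                    four_block_mat (R (M $$ (0, 0))) (L_blk p M + R' (M $$ (0, 0)))
                      (0\<^sub>m (n - 1) (q + 1 - p)) (K_blk n p M) * Q))" if "p \<le> q + 1" for F
    using fwd[of q F] bwd[OF that] by blast
  ultimately show ?thesis by blast
qed

end
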